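(* There exist procedures $P_1$ and $P_2$ that do not use preconditions and only use acyclic tgds in their postconditions, such that the following problem is undecidable: given an instance $I$, is the set $\mathrm{outcomes}_{P_1,P_2}(I)$ nonempty?
   Context: Fix disjoint countably infinite sets of attribute names (totally ordered), domain values $D$, and relation names. A schema $S$ is a partial function with finite domain from relation names to finite sets of attributes; "$R$ is in $S$" means $S(R)$ is defined. An instance $I$ of $S$ assigns to each $R$ in $S$ a finite set $R^I$ of tuples, i.e. functions $S(R)\to D$ (also written as value lists in attribute order). A named atom $R(A_1:x_1,\dots,A_k:x_k)$ (the $x_i$ are variables) is compatible with $S$ if $\{A_1,\dots,A_k\}\subseteq S(R)$; $(I,\tau)$ satisfies it if some $t\in R^I$ has $t(A_i)=\tau(x_i)$ for all $i$. A conjunctive query (CQ) is $\exists \bar z\,\phi(\bar z,\bar y)$ with $\phi$ a conjunction of named atoms; it is compatible with $S$ if all its atoms are, and $Q(I)$ is its set of answers $\tau(\bar y)$. A total query is a relation name $R$; it is compatible with $S$ if $R$ is in $S$, and its result is the set of all (unnamed) tuples in $R^I$. A tgd is $\forall \bar x(\exists \bar y\,\phi(\bar x,\bar y)\to\exists\bar z\,\psi(\bar x,\bar z))$, where $\phi,\psi$ are conjunctions of named atoms. $I\models\Sigma$ means that every CQ in $\Sigma$ is compatible with the schema of $I$ and every dependency in $\Sigma$ holds in $I$ in the usual first-order sense. A tgd is acyclic if no relation on its right-hand side appears on its left-hand side; a set of tgds is acyclic if the directed graph on relation names with an edge from $R$ to $R'$ whenever some tgd in the set has $R$ on the left-hand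 side and $R'$ on the right-hand side is acyclic. A structure constraint is $R[\bar s]$ ($\bar s$ a tuple of attributes) or $R[*]$; a schema $S$ satisfies $R[\bar s]$ if $R$ is in $S$ and all attributes of $\bar s$ belong to $S(R)$, and satisfies $R[*]$ if $R$ is in $S$. A procedure is $P=(\mathrm{Scope},C_{in},C_{out},Q_{pres})$: $\mathrm{Scope}$ is a set of structure constraints, $C_{in}$ and $C_{out}$ (pre- and postconditions) are sets of constraints, and $Q_{pres}$ is a set of queries (CQs or total queries). $P$ is applicable on $I$ over $S$ if each query in $Q_{pres}$ is compatible with $S$ and $I\models C_{in}$. An instance $I'$ over the same schema $S$ is a possible outcome of applying $P$ to $I$ if (1) $P$ is applicable on $I$; (2) $I'\models C_{out}$; (3) $I$ and $I'$ agree outside the scope: $R^I=R^{I'}$ for every $R$ in $S$ not mentioned in $\mathrm{Scope}$, and for every $T$ in $S$ mentioned in $\mathrm{Scope}$ with $T[*]\notin\mathrm{Scope}$, the projections of $T^I$ and $T^{I'}$ onto the attributes of $S(T)$ not mentioned in any $T[\bar s]\in\mathrm{Scope}$ coincide; (4) $Q(I)\subseteq Q(I')$ for each $Q\in Q_{pres}$. $\mathrm{outcomes}_P(I)$ is the set of all possible outcomes; for a set $\mathcal I$ of instances, $\mathrm{outcomes}_P(\mathcal I)=\bigcup_{I\in\mathcal I}\mathrm{outcomes}_P(I)$; and $\mathrm{outcomes}_{P_1,P_2}(I)=\mathrm{outcomes}_{P_2}(\mathrm{outcomes}_{P_1}(I))$. *)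

theory Defs
  imports Main "HOL-Library.Nat_Bijection"
begin

section \<open>Schemas and instances\<close>

text \<open>
  The sets of relation names, attribute names and domain values are three copies of the natural
  numbers; no operation below compares or mixes elements of different sorts. The order on
  attributes is the usual one.
\<close>

type_synonym rel = nat
type_synonym attr = nat
type_synonym val = nat
type_synonym var = nat

type_synonym schema = "rel \<rightharpoonup> attr set"
type_synonym tuple = "attr \<rightharpoonup> val"

definition is_schema :: "schema \<Rightarrow> bool" where
  "is_schema S \<longleftrightarrow> finite (dom S) \<and> (\<forall>X\<in>ran S. finite X)"

record inst =
  schema :: schema
  tuples :: "rel \<Rightarrow> tuple set"

text \<open>
  The last condition only normalises the junk value of \<^const>\<open>tuples\<close> at names outside the schema.
\<close>

definition is_instance :: "inst \<Rightarrow> bool" where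
  "is_instance I \<longleftrightarrow>
     is_schema (schema I) \<and>
     (\<forall>R X. schema I R = Some X \<longrightarrow> finite (tuples I R) \<and> (\<forall>t\<in>tuples I R. dom t = X)) \<and>
     (\<forall>R. schema I R = None \<longrightarrow> tuples I R = {})"

definition unnamed :: "attr set \<Rightarrow> tuple \<Rightarrow> val list" where
  "unnamed X t = map (\<lambda>A. the (t A)) (sorted_list_of_set X)"


section \<open>Queries\<close>

datatype atom = Atom (atom_rel: rel) (atom_args: "(attr \<times> var) list")

definition atom_vars :: "atom \<Rightarrow> var set" where
  "atom_vars a = snd ` set (atom_args a)"

definition compatible_atom :: "schema \<Rightarrow> atom \<Rightarrow> bool" where
  "compatible_atom S a \<longleftrightarrow>
     (\<exists>X. S (atom_rel a) = Some X \<and> fst ` set (atom_args a) \<subseteq> X)"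

definition sat_atom :: "inst \<Rightarrow> (var \<Rightarrow> val) \<Rightarrow> atom \<Rightarrow> bool" where
  "sat_atom I \<tau> a \<longleftrightarrow>
     (\<exists>t\<in>tuples I (atom_rel a). \<forall>(A, x)\<in>set (atom_args a). t A = Some (\<tau> x))"

text \<open>
  \<open>CQ ys \<phi>\<close> has the free variables \<open>ys\<close>; all other variables of \<open>\<phi>\<close> are existentially quantified.
\<close>

datatype query = CQ "var list" "atom list" | Total rel

text \<open>
  Distinctness of the attributes in an atom matters: \<open>R(A : x, A : y)\<close> on the right-hand
  side of a dependency would express the equality of \<open>x\<close> and \<open>y\<close>.
\<close>

definition is_cq :: "var list \<Rightarrow> atom list \<Rightarrow> bool" where
  "is_cq ys \<phi> \<longleftrightarrow>
     \<phi> \<noteq> [] \<and> (\<forall>a\<in>set \<phi>. distinct (map fst (atom_args a))) \<and>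
     set ys \<subseteq> (\<Union>a\<in>set \<phi>. atom_vars a)"

fun is_query :: "query \<Rightarrow> bool" where
  "is_query (CQ ys \<phi>) \<longleftrightarrow> is_cq ys \<phi>"
| "is_query (Total R) \<longleftrightarrow> True"

fun compatible :: "schema \<Rightarrow> query \<Rightarrow> bool" where
  "compatible S (CQ ys \<phi>) \<longleftrightarrow> (\<forall>a\<in>set \<phi>. compatible_atom S a)"
| "compatible S (Total R) \<longleftrightarrow> R \<in> dom S"

fun answers :: "query \<Rightarrow> inst \<Rightarrow> val list set" where
  "answers (CQ ys \<phi>) I = {map \<tau> ys | \<tau>. \<forall>a\<in>set \<phi>. sat_atom I \<tau> a}"
| "answers (Total R) I = unnamed (the (schema I R)) ` tuples I R"


section \<open>Constraints\<close>

text \<open>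
  \<open>TGD xs \<phi> \<psi>\<close> stands for \<open>\<forall>xs. (\<exists>ys. \<phi>(xs, ys)) \<longrightarrow> (\<exists>zs. \<psi>(xs, zs))\<close>, where \<open>ys\<close> and \<open>zs\<close> are
  the variables of \<open>\<phi>\<close> and \<open>\<psi>\<close>, respectively, that are not in \<open>xs\<close>.
\<close>

datatype tgd = TGD (frontier: "var list") (lhs: "atom list") (rhs: "atom list")

definition is_tgd :: "tgd \<Rightarrow> bool" where
  "is_tgd \<sigma> \<longleftrightarrow> is_cq (frontier \<sigma>) (lhs \<sigma>) \<and> is_cq (frontier \<sigma>) (rhs \<sigma>)"

definition holds_tgd :: "inst \<Rightarrow> tgd \<Rightarrow> bool" where
  "holds_tgd I \<sigma> \<longleftrightarrow>
     (\<forall>\<tau>. (\<exists>\<tau>'. (\<forall>x\<in>set (frontier \<sigma>). \<tau>' x = \<tau> x) \<and> (\<forall>a\<in>set (lhs \<sigma>). sat_atom I \<tau>' a)) \<longrightarrow>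
          (\<exists>\<tau>'. (\<forall>x\<in>set (frontier \<sigma>). \<tau>' x = \<tau> x) \<and> (\<forall>a\<in>set (rhs \<sigma>). sat_atom I \<tau>' a)))"

definition lhs_rels :: "tgd \<Rightarrow> rel set" where
  "lhs_rels \<sigma> = atom_rel ` set (lhs \<sigma>)"

definition rhs_rels :: "tgd \<Rightarrow> rel set" where
  "rhs_rels \<sigma> = atom_rel ` set (rhs \<sigma>)"

definition acyclic_tgd :: "tgd \<Rightarrow> bool" where
  "acyclic_tgd \<sigma> \<longleftrightarrow> lhs_rels \<sigma> \<inter> rhs_rels \<sigma> = {}"

definition acyclic_tgds :: "tgd set \<Rightarrow> bool" where
  "acyclic_tgds \<Sigma> \<longleftrightarrow> acyclic (\<Union>\<sigma>\<in>\<Sigma>. lhs_rels \<sigma> \<times> rhs_rels \<sigma>)"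

lemma acyclic_tgds_imp_acyclic_tgd: "acyclic_tgds \<Sigma> \<Longrightarrow> \<sigma> \<in> \<Sigma> \<Longrightarrow> acyclic_tgd \<sigma>"
  unfolding acyclic_tgds_def acyclic_tgd_def acyclic_def by blast

datatype structure_constraint = Attrs rel "attr list" | Whole rel

fun sat_structure :: "schema \<Rightarrow> structure_constraint \<Rightarrow> bool" where
  "sat_structure S (Attrs R s) \<longleftrightarrow> (\<exists>X. S R = Some X \<and> set s \<subseteq> X)"
| "sat_structure S (Whole R) \<longleftrightarrow> R \<in> dom S"

datatype constr = Structure structure_constraint | Tgd tgd

fun is_constraint :: "constr \<Rightarrow> bool" where
  "is_constraint (Structure c) \<longleftrightarrow> True"
| "is_constraint (Tgd \<sigma>) \<longleftrightarrow> is_tgd \<sigma>"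

fun sat_constraint :: "inst \<Rightarrow> constr \<Rightarrow> bool" where
  "sat_constraint I (Structure c) \<longleftrightarrow> sat_structure (schema I) c"
| "sat_constraint I (Tgd \<sigma>) \<longleftrightarrow>
     compatible (schema I) (CQ (frontier \<sigma>) (lhs \<sigma>)) \<and>
     compatible (schema I) (CQ (frontier \<sigma>) (rhs \<sigma>)) \<and>
     holds_tgd I \<sigma>"

definition models :: "inst \<Rightarrow> constr set \<Rightarrow> bool" where
  "models I \<Sigma> \<longleftrightarrow> (\<forall>c\<in>\<Sigma>. sat_constraint I c)"


section \<open>Procedures\<close>

record proc =
  scope :: "structure_constraint set"
  pre :: "constr set"
  post :: "constr set"
  preserved :: "query set"

definition is_procedure :: "proc \<Rightarrow> bool" where
  "is_procedure P \<longleftrightarrow>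
     finite (scope P) \<and> finite (pre P) \<and> finite (post P) \<and> finite (preserved P) \<and>
     (\<forall>c\<in>pre P \<union> post P. is_constraint c) \<and> (\<forall>Q\<in>preserved P. is_query Q)"

definition applicable :: "proc \<Rightarrow> inst \<Rightarrow> bool" where
  "applicable P I \<longleftrightarrow> (\<forall>Q\<in>preserved P. compatible (schema I) Q) \<and> models I (pre P)"

definition mentioned :: "structure_constraint set \<Rightarrow> rel \<Rightarrow> bool" where
  "mentioned Sc R \<longleftrightarrow> Whole R \<in> Sc \<or> (\<exists>s. Attrs R s \<in> Sc)"

definition scope_attrs :: "structure_constraint set \<Rightarrow> rel \<Rightarrow> attr set" where
  "scope_attrs Sc R = \<Union>{set s | s. Attrs R s \<in> Sc}"

definition agree_outside :: "structure_constraint set \<Rightarrow> inst \<Rightarrow> inst \<Rightarrow> bool" where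
  "agree_outside Sc I I' \<longleftrightarrow>
     (\<forall>R X. schema I R = Some X \<longrightarrow>
        (\<not> mentioned Sc R \<longrightarrow> tuples I R = tuples I' R) \<and>
        (mentioned Sc R \<and> Whole R \<notin> Sc \<longrightarrow>
           (\<lambda>t. t |` (X - scope_attrs Sc R)) ` tuples I R =
           (\<lambda>t. t |` (X - scope_attrs Sc R)) ` tuples I' R))"

definition outcomes :: "proc \<Rightarrow> inst \<Rightarrow> inst set" where
  "outcomes P I =
     {I'. is_instance I' \<and> schema I' = schema I \<and>
          applicable P I \<and>
          models I' (post P) \<and>
          agree_outside (scope P) I I' \<and>
          (\<forall>Q\<in>preserved P. answers Q I \<subseteq> answers Q I')}"

definition outcomes_set :: "proc \<Rightarrow> inst set \<Rightarrow> inst set" where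
  "outcomes_set P \<I> = (\<Union>I\<in>\<I>. outcomes P I)"

definition outcomes_seq :: "proc \<Rightarrow> proc \<Rightarrow> inst \<Rightarrow> inst set" where
  "outcomes_seq P\<^sub>1 P\<^sub>2 I = outcomes_set P\<^sub>2 (outcomes P\<^sub>1 I)"

definition no_preconditions :: "proc \<Rightarrow> bool" where
  "no_preconditions P \<longleftrightarrow> pre P = {}"

definition only_acyclic_tgds_post :: "proc \<Rightarrow> bool" where
  "only_acyclic_tgds_post P \<longleftrightarrow> (\<exists>\<Sigma>. post P = Tgd ` \<Sigma> \<and> acyclic_tgds \<Sigma>)"


section \<open>Decidability\<close>

text \<open>
  Partial recursive functions. Minimisation returns the least zero \<open>n\<close> in the first argument and
  requires the function to be defined (and nonzero) on all \<open>m < n\<close>.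
\<close>

datatype recf = Zero | Succ | Proj nat | Comp recf "recf list" | PrimRec recf recf | Mu recf

inductive rec_eval :: "recf \<Rightarrow> nat list \<Rightarrow> nat \<Rightarrow> bool" where
  zero: "rec_eval Zero xs 0"
| succ: "rec_eval Succ [x] (Suc x)"
| proj: "i < length xs \<Longrightarrow> rec_eval (Proj i) xs (xs ! i)"
| comp: "list_all2 (\<lambda>g y. rec_eval g xs y) gs ys \<Longrightarrow> rec_eval f ys z \<Longrightarrow> rec_eval (Comp f gs) xs z"
| prim_0: "rec_eval f xs y \<Longrightarrow> rec_eval (PrimRec f g) (0 # xs) y"
| prim_Suc: "rec_eval (PrimRec f g) (n # xs) r \<Longrightarrow> rec_eval g (n # r # xs) y \<Longrightarrow>
    rec_eval (PrimRec f g) (Suc n # xs) y"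
| mu: "rec_eval f (n # xs) 0 \<Longrightarrow> (\<And>m. m < n \<Longrightarrow> \<exists>y. rec_eval f (m # xs) (Suc y)) \<Longrightarrow>
    rec_eval (Mu f) xs n"

lemma rec_eval_deterministic:
  "rec_eval f xs y \<Longrightarrow> rec_eval f xs z \<Longrightarrow> y = z"
proof (induction f xs y arbitrary: z rule: rec_eval.induct)
  case (comp xs gs ys f z z')
  from comp.prems obtain ys' where
    1: "list_all2 (\<lambda>g y. rec_eval g xs y) gs ys'" and 2: "rec_eval f ys' z'"
    by (cases rule: rec_eval.cases) auto
  have "ys = ys'"
    using comp.IH(1) 1 by (intro nth_equalityI) (auto simp: list_all2_conv_all_nth)
  with 2 comp.IH(2) show ?case by simp
next
  case (prim_Suc f g n xs r y)
  from prim_Suc.prems obtain r' where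
    "rec_eval (PrimRec f g) (n # xs) r'" "rec_eval g (n # r' # xs) z"
    by (cases rule: rec_eval.cases) auto
  with prim_Suc.IH show ?case by metis
next
  case (mu f n xs)
  from mu.prems have 1: "rec_eval f (z # xs) 0"
    and 2: "\<And>m. m < z \<Longrightarrow> \<exists>y. rec_eval f (m # xs) (Suc y)"
    by (cases rule: rec_eval.cases; auto)+
  have "\<not> n < z" using 2[of n] mu.IH(1) by auto
  moreover have "\<not> z < n" using mu.IH(2)[of z] 1 by auto
  ultimately show ?case by simp
next
  case (prim_0 f xs y g)
  from prim_0.prems have "rec_eval f xs z" by (cases rule: rec_eval.cases) auto
  with prim_0.IH show ?case by simp
next
  case (zero xs)
  then show ?case by (cases rule: rec_eval.cases) auto
next
  case (succ x)
  then show ?case by (cases rule: rec_eval.cases) auto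
next
  case (proj i xs)
  from proj.prems show ?case by (cases rule: rec_eval.cases) auto
qed

text \<open>
  The algorithm has to halt with the correct verdict on every element of \<open>X\<close>; nothing is demanded
  of it on numbers that are not codes of elements of \<open>X\<close>.
\<close>

definition decidable_on :: "'a set \<Rightarrow> ('a \<Rightarrow> nat) \<Rightarrow> ('a \<Rightarrow> bool) \<Rightarrow> bool" where
  "decidable_on X code p \<longleftrightarrow>
     (\<exists>f. \<forall>x\<in>X. rec_eval f [code x] (if p x then 1 else 0))"

definition code_table :: "attr set \<Rightarrow> tuple set \<Rightarrow> nat" where
  "code_table X T = prod_encode (set_encode X, set_encode ((\<lambda>t. list_encode (unnamed X t)) ` T))"

definition code_instance :: "inst \<Rightarrow> nat" where
  "code_instance I =
     set_encode ((\<lambda>R. prod_encode (R, code_table (the (schema I R)) (tuples I R))) ` dom (schema I))"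

lemma unnamed_inj:
  assumes "finite X" "dom t = X" "dom u = X" "unnamed X t = unnamed X u"
  shows "t = u"
proof
  fix A
  show "t A = u A"
  proof (cases "A \<in> X")
    case True
    with assms have "the (t A) = the (u A)" by (auto simp: unnamed_def)
    moreover obtain v w where "t A = Some v" "u A = Some w" using True assms(2,3) by blast
    ultimately show ?thesis by simp
  next
    case False
    with assms(2,3) show ?thesis by (metis domIff)
  qed
qed

lemma code_table_inj:
  assumes "finite X" "finite T" "\<forall>t\<in>T. dom t = X"
    and "finite Y" "finite U" "\<forall>t\<in>U. dom t = Y"
    and "code_table X T = code_table Y U"
  shows "X = Y \<and> T = U"
proof -
  let ?c = "\<lambda>X t. list_encode (unnamed X t)"
  have e: "set_encode X = set_encode Y" "set_encode (?c X ` T) = set_encode (?c Y ` U)"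
    using assms(7) by (simp_all add: code_table_def)
  have XY: "X = Y" using e(1) set_encode_eq[OF assms(1,4)] by simp
  have im: "?c X ` T = ?c X ` U"
    using e(2) set_encode_eq[of "?c X ` T" "?c Y ` U"] assms(2,5) XY by simp
  have "inj_on (?c X) (T \<union> U)"
  proof (rule inj_onI)
    fix t u
    assume t: "t \<in> T \<union> U" and u: "u \<in> T \<union> U" and c: "?c X t = ?c X u"
    have dom: "dom w = X" if "w \<in> T \<union> U" for w
      using that
    proof
      assume "w \<in> T" then show ?thesis using assms(3) by simp
    next
      assume "w \<in> U" then show ?thesis using assms(6) XY by simp
    qed
    from c have "unnamed X t = unnamed X u" by (simp only: list_encode_eq)
    with dom[OF t] dom[OF u] show "t = u" by (rule unnamed_inj[OF assms(1)])
  qed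
  with im have "T = U" using inj_on_image_eq_iff[of "?c X" "T \<union> U" T U] by simp
  with XY show ?thesis by simp
qed

lemma code_instance_inj: "inj_on code_instance {I. is_instance I}"
proof (rule inj_onI, clarify)
  fix I J
  assume I: "is_instance I" and J: "is_instance J" and eq: "code_instance I = code_instance J"
  define c where "c K R = code_table (the (schema K R)) (tuples K R)" for K :: inst and R
  have fin: "finite (dom (schema I))" "finite (dom (schema J))"
    using I J by (auto simp: is_instance_def is_schema_def)
  have im: "(\<lambda>R. prod_encode (R, c I R)) ` dom (schema I) =
            (\<lambda>R. prod_encode (R, c J R)) ` dom (schema J)" (is "?A = ?B")
  proof -
    have "set_encode ?A = set_encode ?B" using eq by (simp add: code_instance_def c_def)
    then show ?thesis using set_encode_eq[of ?A ?B] fin by simp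
  qed
  have half: "R \<in> dom (schema J) \<and> c I R = c J R" if "R \<in> dom (schema I)" for R
  proof -
    have "prod_encode (R, c I R) \<in> ?B" using im that by blast
    then show ?thesis by auto
  qed
  have half': "R \<in> dom (schema I)" if "R \<in> dom (schema J)" for R
  proof -
    have "prod_encode (R, c J R) \<in> ?A" using im that by blast
    then show ?thesis by auto
  qed
  have both: "schema I R = schema J R \<and> tuples I R = tuples J R" for R
  proof (cases "R \<in> dom (schema I)")
    case True
    then obtain X where X: "schema I R = Some X" by blast
    from half[OF True] obtain Y where Y: "schema J R = Some Y" and c: "c I R = c J R" by blast
    have "finite X" "finite Y"
      using I J X Y by (auto simp: is_instance_def is_schema_def ran_def)
    moreover have "code_table X (tuples I R) = code_table Y (tuples J R)"
      using c X Y by (simp add: c_def)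
    ultimately have "X = Y \<and> tuples I R = tuples J R"
      using I J X Y by (intro code_table_inj) (auto simp: is_instance_def)
    with X Y show ?thesis by simp
  next
    case False
    with half' have "schema I R = None" "schema J R = None" by auto
    with I J show ?thesis by (auto simp: is_instance_def)
  qed
  then have "schema I = schema J" "tuples I = tuples J" by auto
  then show "I = J" by simp
qed

end

theory Submission
  imports Defs "HOL-Library.Countable"
begin

text \<open>
  The procedure \<open>P\<^sub>2\<close> has empty scope, so \<open>P\<^sub>1\<close> and \<open>P\<^sub>2\<close> together ask for one finite instance
  that satisfies both sets of postconditions. Their union may be cyclic: \<open>P\<^sub>1\<close> derives facts
  over primed copies of the relations in its scope, and \<open>P\<^sub>2\<close> copies them back. Hence arbitrary
  tgds can be simulated, and these can interpret partial recursive functions: a program \<open>e\<close> is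
  stored in the input as its syntax tree, a number \<open>n\<close> in unary, evaluation proceeds on demand,
  and a positive result of \<open>e(n)\<close> forces a tuple into a relation outside the scope, which is empty
  in the input. If \<open>e(n) = 0\<close>, the facts demanded by the terminating evaluation form a finite
  model; if \<open>e(n) = 1\<close>, there is no model.

  A decision procedure \<open>f\<close> is refuted by diagonalisation. Let \<open>n\<close> be the code of the instance
  that holds only the syntax tree of \<open>e\<close>. Adding the unary representation of \<open>n\<close> to this
  instance changes its code in a way that is computable from \<open>n\<close>, by some \<open>g\<close>; so \<open>e\<close> can be
  chosen to be the composition of \<open>f\<close> and \<open>g\<close>.
\<close>

subsection \<open>Computable functions\<close>

definition computable :: "nat \<Rightarrow> (nat list \<Rightarrow> nat) \<Rightarrow> bool" where
  "computable k F \<longleftrightarrow> (\<exists>r. \<forall>xs. length xs = k \<longrightarrow> rec_eval r xs (F xs))"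

lemma computable_cong:
  "computable k F \<Longrightarrow> (\<And>xs. length xs = k \<Longrightarrow> F xs = G xs) \<Longrightarrow> computable k G"
  unfolding computable_def by simp

lemma computable_nth: "i < k \<Longrightarrow> computable k (\<lambda>xs. xs ! i)"
  unfolding computable_def by (metis rec_eval.proj)

lemma computable_comp:
  assumes "computable (length Gs) F" and "\<And>G. G \<in> set Gs \<Longrightarrow> computable k G"
  shows "computable k (\<lambda>xs. F (map (\<lambda>G. G xs) Gs))"
proof -
  obtain f where f: "\<And>xs. length xs = length Gs \<Longrightarrow> rec_eval f xs (F xs)"
    using assms(1) unfolding computable_def by blast
  obtain r where r: "\<And>G xs. G \<in> set Gs \<Longrightarrow> length xs = k \<Longrightarrow> rec_eval (r G) xs (G xs)"
    using assms(2) unfolding computable_def by metis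
  have "rec_eval (Comp f (map r Gs)) xs (F (map (\<lambda>G. G xs) Gs))" if "length xs = k" for xs
    using that r f
    by (intro rec_eval.comp[where ys = "map (\<lambda>G. G xs) Gs"]) (auto simp: list_all2_conv_all_nth)
  then show ?thesis unfolding computable_def by blast
qed

lemma computable_comp1:
  "computable 1 (\<lambda>xs. f (xs ! 0)) \<Longrightarrow> computable k G \<Longrightarrow> computable k (\<lambda>xs. f (G xs))"
  using computable_comp[of "[G]" "\<lambda>xs. f (xs ! 0)" k] by simp

lemma computable_comp2:
  "computable 2 (\<lambda>xs. f (xs ! 0) (xs ! 1)) \<Longrightarrow> computable k G \<Longrightarrow> computable k H \<Longrightarrow>
    computable k (\<lambda>xs. f (G xs) (H xs))"
  using computable_comp[of "[G, H]" "\<lambda>xs. f (xs ! 0) (xs ! 1)" k] by (auto simp: numeral_2_eq_2)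

text \<open>\<open>PrimRec\<close> hands to its step the counter, then the previous value, then the
  parameters; this dictates the argument order of \<open>H\<close>.\<close>

lemma computable_rec:
  assumes "computable k F" and "computable (Suc (Suc k)) H"
  shows "computable (Suc k) (\<lambda>xs. rec_nat (F (tl xs)) (\<lambda>n r. H (n # r # tl xs)) (xs ! 0))"
proof -
  obtain f where f: "\<And>xs. length xs = k \<Longrightarrow> rec_eval f xs (F xs)"
    using assms(1) unfolding computable_def by blast
  obtain h where h: "\<And>xs. length xs = Suc (Suc k) \<Longrightarrow> rec_eval h xs (H xs)"
    using assms(2) unfolding computable_def by blast
  have "rec_eval (PrimRec f h) (n # xs) (rec_nat (F xs) (\<lambda>n r. H (n # r # xs)) n)"
    if "length xs = k" for n xs
    by (induction n) (auto intro!: rec_eval.prim_0 rec_eval.prim_Suc f h simp: that)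
  then show ?thesis
    unfolding computable_def by (intro exI[of _ "PrimRec f h"]) (auto simp: length_Suc_conv)
qed

lemma computable_Suc: "computable k F \<Longrightarrow> computable k (\<lambda>xs. Suc (F xs))"
proof (rule computable_comp1[of Suc])
  show "computable 1 (\<lambda>xs. Suc (xs ! 0))"
    unfolding computable_def
  proof (intro exI allI impI)
    fix xs :: "nat list" assume "length xs = 1"
    then show "rec_eval Succ xs (Suc (xs ! 0))"
      using rec_eval.succ[of "xs ! 0"] by (cases xs) auto
  qed
qed

lemma computable_const: "computable k (\<lambda>_. c)"
proof (induction c)
  case 0
  show ?case unfolding computable_def by (metis rec_eval.zero)
qed (rule computable_Suc)

lemma computable_add:
  assumes "computable k F" "computable k G"
  shows "computable k (\<lambda>xs. F xs + G xs)"
proof (rule computable_comp2[OF _ assms])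
  have "rec_nat b (\<lambda>n r. Suc r) a = a + b" for a b :: nat by (induction a) auto
  with computable_rec[of 1 "\<lambda>xs. xs ! 0" "\<lambda>xs. Suc (xs ! 1)"]
  have "computable 2 (\<lambda>xs. xs ! 0 + tl xs ! 0)"
    by (simp add: computable_nth computable_Suc numeral_2_eq_2)
  then show "computable 2 (\<lambda>xs. xs ! 0 + xs ! 1)"
    by (rule computable_cong) (simp add: nth_tl)
qed

lemma computable_power2:
  assumes "computable k F"
  shows "computable k (\<lambda>xs. 2 ^ F xs)"
proof (rule computable_comp1[OF _ assms])
  have "rec_nat 1 (\<lambda>n r. r + r) a = (2 :: nat) ^ a" for a :: nat by (induction a) auto
  with computable_rec[of 0 "\<lambda>_. 1" "\<lambda>xs. xs ! 1 + xs ! 1"]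
  show "computable 1 (\<lambda>xs. 2 ^ (xs ! 0))"
    by (simp add: computable_nth computable_add computable_const)
qed

text \<open>\<open>prod_encode\<close> is the Cantor pairing: the triangular number of the sum plus
  the first component. Only the triangular numbers need a recursion.\<close>

lemma computable_prod_encode:
  assumes "computable k F" "computable k G"
  shows "computable k (\<lambda>xs. prod_encode (F xs, G xs))"
proof -
  have "rec_nat 0 (\<lambda>n r. r + Suc n) a = triangle a" for a :: nat by (induction a) auto
  with computable_rec[of 0 "\<lambda>_. 0" "\<lambda>xs. xs ! 1 + Suc (xs ! 0)"]
  have "computable 1 (\<lambda>xs. triangle (xs ! 0))"
    by (simp add: computable_nth computable_add computable_const computable_Suc del: add_Suc_right)
  from computable_comp1[OF this] show ?thesis
    unfolding prod_encode_def by (simp add: assms computable_add)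
qed

text \<open>Sums of this form are values of \<open>set_encode\<close> on sets enumerated by
  \<open>i\<close>; the table of \<open>rNum\<close> is encoded in this way.\<close>

lemma computable_sum_power2:
  assumes "computable 2 (\<lambda>xs. h (xs ! 0) (xs ! 1))"
  shows "computable 1 (\<lambda>xs. \<Sum>i<xs ! 0. 2 ^ h i (xs ! 0))"
proof -
  \<comment> \<open>The argument occurs both as the length of the sum and inside the summands. The
    two roles are separated, so that the recursion on the first keeps the second fixed, and are
    identified again at the end.\<close>
  define s where "s a b = (\<Sum>i<a. 2 ^ h i b :: nat)" for a b
  have s: "rec_nat 0 (\<lambda>n r. r + 2 ^ h n b) a = s a b" for a b :: nat
    unfolding s_def by (induction a) auto
  have "computable 3 (\<lambda>xs. h (xs ! 0) (xs ! 2))"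
    by (rule computable_comp2[where f = h, OF assms]) (auto intro: computable_nth)
  then have "computable (Suc (Suc 1)) (\<lambda>xs. xs ! 1 + 2 ^ h (xs ! 0) (xs ! 2))"
    by (intro computable_add computable_power2) (auto intro: computable_nth simp: numeral_3_eq_3)
  from computable_rec[OF computable_const[of 1 0] this, unfolded Suc_1]
  have *: "computable 2 (\<lambda>xs. s (xs ! 0) (tl xs ! 0))"
    by (simp add: s)
  have "computable 2 (\<lambda>xs. s (xs ! 0) (xs ! 1))"
    using * by (rule computable_cong) (simp add: nth_tl)
  then show ?thesis
    unfolding s_def[symmetric]
    by (rule computable_comp2[where f = s]) (auto intro: computable_nth)
qed

subsection \<open>Rules\<close>

type_synonym ratom = "rel \<times> var list"
type_synonym rule = "ratom list \<times> ratom list"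

fun mk_atom :: "ratom \<Rightarrow> atom" where
  "mk_atom (R, vs) = Atom R (enumerate 0 vs)"

definition vars :: "ratom list \<Rightarrow> var set" where
  "vars \<phi> = (\<Union>(R, vs)\<in>set \<phi>. set vs)"

text \<open>Since \<open>is_tgd\<close> wants the frontier to occur on both sides, it consists of
  the shared variables. A variable of the body alone is existential in the premise, hence universal
  for the implication.\<close>

definition mk_tgd :: "rule \<Rightarrow> tgd" where
  "mk_tgd r = TGD (filter (\<lambda>x. x \<in> vars (snd r)) (concat (map snd (fst r))))
     (map mk_atom (fst r)) (map mk_atom (snd r))"

text \<open>
  Every relation has the attributes 0, 1 and 2; an atom with fewer arguments leaves the last
  attributes unconstrained.
\<close>

definition holds :: "inst \<Rightarrow> rel \<Rightarrow> val list \<Rightarrow> bool" where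
  "holds I R xs \<longleftrightarrow> (\<exists>t\<in>tuples I R. \<forall>i<length xs. t i = Some (xs ! i))"

definition obeys :: "inst \<Rightarrow> rule \<Rightarrow> bool" where
  "obeys I r \<longleftrightarrow> (\<forall>\<tau>. (\<forall>(R, vs)\<in>set (fst r). holds I R (map \<tau> vs)) \<longrightarrow>
     (\<exists>\<tau>'. (\<forall>x\<in>vars (fst r). \<tau>' x = \<tau> x) \<and> (\<forall>(R, vs)\<in>set (snd r). holds I R (map \<tau>' vs))))"

text \<open>Here \<open>w\<close> is a Skolem function that computes the values of the head from
  those matched in the body.\<close>

lemma obeysI:
  assumes "\<And>\<tau>. \<forall>(R, vs)\<in>set (fst r). holds I R (map \<tau> vs) \<Longrightarrow>
    (\<forall>x\<in>vars (fst r). w \<tau> x = \<tau> x) \<and> (\<forall>(R, vs)\<in>set (snd r). holds I R (map (w \<tau>) vs))"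
  shows "obeys I r"
  unfolding obeys_def using assms by (intro allI impI exI)

lemma sat_mk_atom: "sat_atom I \<tau> (mk_atom a) \<longleftrightarrow> holds I (fst a) (map \<tau> (snd a))"
proof (cases a)
  case (Pair R vs)
  have "(\<forall>(A, x)\<in>set (enumerate 0 vs). t A = Some (\<tau> x)) \<longleftrightarrow>
      (\<forall>i<length vs. t i = Some (\<tau> (vs ! i)))" for t :: tuple
    by (force simp: in_set_enumerate_eq)
  with Pair show ?thesis by (simp add: sat_atom_def holds_def cong: conj_cong)
qed

lemma atom_vars_mk_atom: "atom_vars (mk_atom a) = set (snd a)"
proof (cases a)
  case (Pair R vs)
  have "snd ` set (enumerate 0 vs) = set vs"
    by (metis list.set_map map_snd_enumerate)
  with Pair show ?thesis by (simp add: atom_vars_def)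
qed

text \<open>The two notions differ in the variables that a witness has to preserve: all those of the
  body for \<open>obeys\<close>, only the shared ones for \<open>holds_tgd\<close>. Body variables
  that do not occur in the head can be reset freely.\<close>

lemma holds_mk_tgd: "holds_tgd I (mk_tgd r) \<longleftrightarrow> obeys I r"
proof
  have fr: "set (frontier (mk_tgd r)) = vars (fst r) \<inter> vars (snd r)"
    by (force simp: mk_tgd_def vars_def)
  show "obeys I r" if h: "holds_tgd I (mk_tgd r)"
    unfolding obeys_def
  proof (intro allI impI)
    fix \<tau> assume b: "\<forall>(R, vs)\<in>set (fst r). holds I R (map \<tau> vs)"
    have "\<forall>a\<in>set (lhs (mk_tgd r)). sat_atom I \<tau> a"
      using b by (auto simp: mk_tgd_def sat_mk_atom)
    then obtain \<tau>' where 1: "\<forall>x\<in>vars (fst r) \<inter> vars (snd r). \<tau>' x = \<tau> x"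
      and 2: "\<forall>a\<in>set (rhs (mk_tgd r)). sat_atom I \<tau>' a"
      using h fr unfolding holds_tgd_def by metis
    \<comment> \<open>On the shared variables both assignments agree, so resetting the body
      variables leaves the head atoms as they are.\<close>
    let ?\<sigma> = "\<lambda>x. if x \<in> vars (fst r) then \<tau> x else \<tau>' x"
    have "holds I R (map ?\<sigma> vs)" if "(R, vs) \<in> set (snd r)" for R vs
    proof -
      have "x \<in> vars (snd r)" if "x \<in> set vs" for x
        using that \<open>(R, vs) \<in> set (snd r)\<close> by (auto simp: vars_def)
      then have eq: "map ?\<sigma> vs = map \<tau>' vs" using 1 by auto
      moreover have "holds I R (map \<tau>' vs)" using 2 that by (auto simp: mk_tgd_def sat_mk_atom)
      ultimately show ?thesis by (simp only: eq)
    qed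
    then show "\<exists>\<tau>'. (\<forall>x\<in>vars (fst r). \<tau>' x = \<tau> x) \<and> (\<forall>(R, vs)\<in>set (snd r). holds I R (map \<tau>' vs))"
      by (intro exI[of _ ?\<sigma>]) auto
  qed
  show "holds_tgd I (mk_tgd r)" if o: "obeys I r"
    unfolding holds_tgd_def
  proof (intro allI impI, elim exE conjE)
    fix \<tau> \<tau>' assume 1: "\<forall>x\<in>set (frontier (mk_tgd r)). \<tau>' x = \<tau> x"
      and 2: "\<forall>a\<in>set (lhs (mk_tgd r)). sat_atom I \<tau>' a"
    have "\<forall>(R, vs)\<in>set (fst r). holds I R (map \<tau>' vs)"
      using 2 by (auto simp: mk_tgd_def sat_mk_atom)
    then obtain \<sigma> where 3: "\<forall>x\<in>vars (fst r). \<sigma> x = \<tau>' x"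
      and 4: "\<forall>(R, vs)\<in>set (snd r). holds I R (map \<sigma> vs)"
      using o unfolding obeys_def by blast
    show "\<exists>\<tau>'. (\<forall>x\<in>set (frontier (mk_tgd r)). \<tau>' x = \<tau> x) \<and> (\<forall>a\<in>set (rhs (mk_tgd r)). sat_atom I \<tau>' a)"
    proof (intro exI[of _ \<sigma>] conjI ballI)
      show "\<sigma> x = \<tau> x" if "x \<in> set (frontier (mk_tgd r))" for x
        using that 1 3 fr by auto
      show "sat_atom I \<sigma> a" if "a \<in> set (rhs (mk_tgd r))" for a
        using that 4 by (auto simp: mk_tgd_def sat_mk_atom simp del: mk_atom.simps)
    qed
  qed
qed

definition ok_rule :: "rule \<Rightarrow> bool" where
  "ok_rule r \<longleftrightarrow> fst r \<noteq> [] \<and> snd r \<noteq> [] \<and>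
     (\<forall>(R, vs)\<in>set (fst r) \<union> set (snd r). R < 24 \<and> length vs \<le> 3)"

lemma is_tgd_mk_tgd: "ok_rule r \<Longrightarrow> is_tgd (mk_tgd r)"
  by (auto simp: is_tgd_def is_cq_def mk_tgd_def atom_vars_mk_atom ok_rule_def vars_def
      map_fst_enumerate)

text \<open>
  \<open>rDem p l\<close>: program \<open>p\<close> is to be run on the list \<open>l\<close>; \<open>rRes p l v\<close>: the result is \<open>v\<close>;
  \<open>rSearch p l m\<close>: a minimisation \<open>p\<close> on \<open>l\<close> has found no zero below \<open>m\<close>; \<open>rCons x l l'\<close>: the list
  \<open>l'\<close> has head \<open>x\<close> and tail \<open>l\<close>; \<open>rSuc x y\<close>: \<open>y = x + 1\<close>. Only these relations, numbered
  below 5, and their primed copies, numbered from 5 to 9, are in the scope. The relations \<open>pZero\<close>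
  to \<open>pMu\<close> hold the syntax tree of the program named by \<open>rRoot\<close>; a projection \<open>Proj (Suc i)\<close> has
  the child \<open>Proj i\<close>, and a list of programs is a node whose result is the list of their results.
  The number \<open>n > 0\<close> is given by the tuples \<open>(i, i + 1, n)\<close> in \<open>rNum\<close> with \<open>i < n\<close>.
\<close>

abbreviation (input) "rDem \<equiv> 0 :: rel"
abbreviation (input) "rRes \<equiv> 1 :: rel"
abbreviation (input) "rSearch \<equiv> 2 :: rel"
abbreviation (input) "rCons \<equiv> 3 :: rel"
abbreviation (input) "rSuc \<equiv> 4 :: rel"
abbreviation (input) "rZ \<equiv> 10 :: rel"
abbreviation (input) "rNil \<equiv> 11 :: rel"
abbreviation (input) "pZero \<equiv> 12 :: rel"
abbreviation (input) "pSucc \<equiv> 13 :: rel"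
abbreviation (input) "pHd \<equiv> 14 :: rel"
abbreviation (input) "pTl \<equiv> 15 :: rel"
abbreviation (input) "pComp \<equiv> 16 :: rel"
abbreviation (input) "pNil \<equiv> 17 :: rel"
abbreviation (input) "pCons \<equiv> 18 :: rel"
abbreviation (input) "pPrim \<equiv> 19 :: rel"
abbreviation (input) "pMu \<equiv> 20 :: rel"
abbreviation (input) "rRoot \<equiv> 21 :: rel"
abbreviation (input) "rFail \<equiv> 22 :: rel"
abbreviation (input) "rNum \<equiv> 23 :: rel"

definition rules :: "rule list" where
  "rules = [
    ([(rNum, [0,1,2])], [(rSuc, [0,1])]),
    ([(rNum, [0,1,2]), (rRoot, [3]), (rNil, [4])], [(rCons, [2,4,5]), (rDem, [3,5])]),
    ([(rNum, [0,1,2]), (rRoot, [3]), (rNil, [4]), (rCons, [2,4,5]), (rRes, [3,5,6]), (rSuc, [7,6])],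
       [(rFail, [6])]),
    ([(rDem, [0,1]), (pZero, [0]), (rZ, [2])], [(rRes, [0,1,2])]),
    ([(rDem, [0,1]), (pSucc, [0]), (rCons, [2,3,1]), (rNil, [3])], [(rSuc, [2,4]), (rRes, [0,1,4])]),
    ([(rDem, [0,1]), (pHd, [0]), (rCons, [2,3,1])], [(rRes, [0,1,2])]),
    ([(rDem, [0,1]), (pTl, [0,4]), (rCons, [2,3,1])], [(rDem, [4,3])]),
    ([(rDem, [0,1]), (pTl, [0,4]), (rCons, [2,3,1]), (rRes, [4,3,5])], [(rRes, [0,1,5])]),
    ([(rDem, [0,1]), (pNil, [0]), (rNil, [2])], [(rRes, [0,1,2])]),
    ([(rDem, [0,1]), (pCons, [0,2,3])], [(rDem, [2,1]), (rDem, [3,1])]),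
    ([(rDem, [0,1]), (pCons, [0,2,3]), (rRes, [2,1,4]), (rRes, [3,1,5])],
       [(rCons, [4,5,6]), (rRes, [0,1,6])]),
    ([(rDem, [0,1]), (pComp, [0,2,3])], [(rDem, [3,1])]),
    ([(rDem, [0,1]), (pComp, [0,2,3]), (rRes, [3,1,4])], [(rDem, [2,4])]),
    ([(rDem, [0,1]), (pComp, [0,2,3]), (rRes, [3,1,4]), (rRes, [2,4,5])], [(rRes, [0,1,5])]),
    ([(rDem, [0,1]), (pPrim, [0,2,3]), (rCons, [4,5,1]), (rZ, [4])], [(rDem, [2,5])]),
    ([(rDem, [0,1]), (pPrim, [0,2,3]), (rCons, [4,5,1]), (rZ, [4]), (rRes, [2,5,6])],
       [(rRes, [0,1,6])]),
    ([(rDem, [0,1]), (pPrim, [0,2,3]), (rCons, [4,5,1]), (rSuc, [6,4])],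
       [(rCons, [6,5,7]), (rDem, [0,7])]),
    ([(rDem, [0,1]), (pPrim, [0,2,3]), (rCons, [4,5,1]), (rSuc, [6,4]), (rCons, [6,5,7]),
        (rRes, [0,7,8])],
       [(rCons, [8,5,9]), (rCons, [6,9,10]), (rDem, [3,10])]),
    ([(rDem, [0,1]), (pPrim, [0,2,3]), (rCons, [4,5,1]), (rSuc, [6,4]), (rCons, [6,5,7]),
        (rRes, [0,7,8]), (rCons, [8,5,9]), (rCons, [6,9,10]), (rRes, [3,10,11])],
       [(rRes, [0,1,11])]),
    ([(rDem, [0,1]), (pMu, [0,2]), (rZ, [3])], [(rSearch, [0,1,3])]),
    ([(rSearch, [0,1,3]), (pMu, [0,2])], [(rCons, [3,1,4]), (rDem, [2,4])]),
    ([(rSearch, [0,1,3]), (pMu, [0,2]), (rCons, [3,1,4]), (rRes, [2,4,5]), (rZ, [5])],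
       [(rRes, [0,1,3])]),
    ([(rSearch, [0,1,3]), (pMu, [0,2]), (rCons, [3,1,4]), (rRes, [2,4,5]), (rSuc, [6,5])],
       [(rSuc, [3,7]), (rSearch, [0,1,7])])]"

section \<open>Splitting the rules into two acyclic procedures\<close>

definition prime :: "rel \<Rightarrow> rel" where
  "prime R = (if R < 5 then R + 5 else R)"

definition forward :: "rule list" where
  "forward = map (\<lambda>r. (fst r, map (map_prod prime id) (snd r))) rules"

text \<open>The copying rules have full width: an atom with fewer arguments would leave the other
  attributes of the copy open.\<close>

definition backward :: "rule list" where
  "backward = map (\<lambda>R. ([(prime R, [0,1,2])], [(R, [0,1,2])])) [0..<5]"

definition proc1 :: proc where
  "proc1 = \<lparr>scope = Whole ` {..<10}, pre = {}, post = Tgd ` mk_tgd ` set forward, preserved = {}\<rparr>"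

definition proc2 :: proc where
  "proc2 = \<lparr>scope = {}, pre = {}, post = Tgd ` mk_tgd ` set backward, preserved = {}\<rparr>"

lemma rules_rels:
  "r \<in> set rules \<Longrightarrow> fst r \<noteq> [] \<and> snd r \<noteq> [] \<and>
    (\<forall>(R, vs)\<in>set (fst r). (R < 5 \<or> 10 \<le> R \<and> R < 24 \<and> R \<noteq> rFail) \<and> length vs \<le> 3) \<and>
    (\<forall>(R, vs)\<in>set (snd r). (R < 5 \<or> R = rFail) \<and> length vs \<le> 3)"
proof -
  have "list_all (\<lambda>r. fst r \<noteq> [] \<and> snd r \<noteq> [] \<and>
    list_all (\<lambda>(R, vs). (R < 5 \<or> 10 \<le> R \<and> R < 24 \<and> R \<noteq> rFail) \<and> length vs \<le> 3) (fst r) \<and>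
    list_all (\<lambda>(R, vs). (R < 5 \<or> R = rFail) \<and> length vs \<le> 3) (snd r)) rules"
    by (simp add: rules_def)
  then show "r \<in> set rules \<Longrightarrow> ?thesis" by (simp add: list_all_iff)
qed

lemma ok_forward: "r \<in> set forward \<Longrightarrow> ok_rule r"
  unfolding forward_def by (fastforce dest: rules_rels simp: ok_rule_def prime_def)

lemma ok_backward: "r \<in> set backward \<Longrightarrow> ok_rule r"
  unfolding backward_def by (auto simp: ok_rule_def prime_def)

text \<open>Edges from a set into a disjoint one cannot be composed, so the transitive closure adds
  nothing, and a loop would need a point in both sets.\<close>

lemma acyclic_disjoint: "A \<inter> B = {} \<Longrightarrow> E \<subseteq> A \<times> B \<Longrightarrow> acyclic E"
proof (rule acyclicI, intro allI notI)
  fix x assume d: "A \<inter> B = {}" and E: "E \<subseteq> A \<times> B" and x: "(x, x) \<in> E\<^sup>+"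
  have "E\<^sup>+ \<subseteq> (A \<times> B)\<^sup>+" using E trancl_mono by blast
  also have "trans (A \<times> B)" using d by (auto simp: trans_def)
  then have "(A \<times> B)\<^sup>+ = A \<times> B" by (rule trancl_id)
  finally show False using x d by auto
qed

lemma rels_mk_tgd:
  "lhs_rels (mk_tgd r) = fst ` set (fst r)" "rhs_rels (mk_tgd r) = fst ` set (snd r)"
proof -
  have *: "atom_rel \<circ> mk_atom = fst" by auto
  show "lhs_rels (mk_tgd r) = fst ` set (fst r)" "rhs_rels (mk_tgd r) = fst ` set (snd r)"
    by (simp_all add: lhs_rels_def rhs_rels_def mk_tgd_def image_comp *)
qed

text \<open>Priming separates the heads from the bodies; the only head relation that stays unprimed,
  \<open>rFail\<close>, occurs in no body.\<close>

lemma acyclic_forward: "acyclic_tgds (mk_tgd ` set forward)"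
  unfolding acyclic_tgds_def
  by (rule acyclic_disjoint[of "{..<5} \<union> {10..} - {rFail}" "{5..<10} \<union> {rFail}"])
     (fastforce dest: rules_rels simp: rels_mk_tgd forward_def prime_def)+

lemma acyclic_backward: "acyclic_tgds (mk_tgd ` set backward)"
  unfolding acyclic_tgds_def
  by (rule acyclic_disjoint[of "{5..<10}" "{..<5}"])
     (auto simp: rels_mk_tgd backward_def prime_def)

section \<open>Outcomes of the sequence as models of the rules\<close>

definition full :: "nat \<Rightarrow> schema" where
  "full k = (\<lambda>R. if R < k then Some {0, 1, 2} else None)"

lemma compatible_ok_rule:
  assumes "ok_rule r" "I = full 24"
  shows "compatible I (CQ ys (map mk_atom (fst r))) \<and> compatible I (CQ ys (map mk_atom (snd r)))"
proof -
  have c: "compatible_atom I (mk_atom (R, vs))" if "R < 24" "length vs \<le> 3" for R vs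
  proof -
    have "fst ` set (enumerate 0 vs) = {0..<length vs}"
      by (metis add_0 list.set_map map_fst_enumerate set_upt)
    also have "\<dots> \<subseteq> {0, 1, 2}" using that by auto
    finally show ?thesis using that assms by (simp add: compatible_atom_def full_def)
  qed
  have "compatible_atom I (mk_atom a)" if "a \<in> set (fst r) \<union> set (snd r)" for a
    using assms(1) that c[of "fst a" "snd a"] unfolding ok_rule_def
    by (metis (mono_tags, lifting) case_prod_beta prod.collapse)
  then show ?thesis by simp
qed

lemma models_rules:
  assumes "schema I = full 24" "\<And>r. r \<in> set rs \<Longrightarrow> ok_rule r"
  shows "models I (Tgd ` mk_tgd ` set rs) \<longleftrightarrow> (\<forall>r\<in>set rs. obeys I r)"
proof -
  have "sat_constraint I (Tgd (mk_tgd r)) \<longleftrightarrow> obeys I r" if "r \<in> set rs" for r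
    using compatible_ok_rule[OF assms(2)[OF that] assms(1)] holds_mk_tgd
    by (simp add: mk_tgd_def)
  then show ?thesis by (simp add: models_def)
qed

text \<open>The forward rule yields the head atoms in primed form, and the backward rules copy them
  back with the same witness.\<close>

lemma obeys_forward_backward:
  assumes full: "is_instance K" "schema K = full 24"
    and f: "\<forall>r\<in>set forward. obeys K r" and b: "\<forall>r\<in>set backward. obeys K r"
    and r: "r \<in> set rules"
  shows "obeys K r"
  unfolding obeys_def
proof (intro allI impI)
  fix \<tau> assume a: "\<forall>(R, vs)\<in>set (fst r). holds K R (map \<tau> vs)"
  have "obeys K (fst r, map (map_prod prime id) (snd r))"
    using f r unfolding forward_def by auto
  then obtain \<tau>' where 1: "\<forall>x\<in>vars (fst r). \<tau>' x = \<tau> x"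
    and 2: "\<forall>(R, vs)\<in>set (map (map_prod prime id) (snd r)). holds K R (map \<tau>' vs)"
    using a unfolding obeys_def fst_conv snd_conv by blast
  have "holds K R (map \<tau>' vs)" if R: "(R, vs) \<in> set (snd r)" for R vs
  proof (cases "R < 5")
    case True
    have len: "length vs \<le> 3" using rules_rels[OF r] R by auto
    have "(prime R, vs) \<in> set (map (map_prod prime id) (snd r))" using R by force
    then have h: "holds K (prime R) (map \<tau>' vs)" using 2 by blast
    then obtain t where t: "t \<in> tuples K (prime R)" "\<forall>i<length vs. t i = Some (\<tau>' (vs ! i))"
      by (auto simp: holds_def)
    \<comment> \<open>The atom may mention fewer than three attributes. The schema makes the
      matching tuple total on all three, so that the copying rule applies to it.\<close>
    have "schema K (prime R) = Some {0, 1, 2}" using True full by (simp add: full_def prime_def)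
    then have "dom t = {0, 1, 2}" using full t by (auto simp: is_instance_def)
    then have "0 \<in> dom t" "1 \<in> dom t" "2 \<in> dom t" by auto
    then obtain a0 a1 a2 where a: "t 0 = Some a0" "t 1 = Some a1" "t 2 = Some a2" by blast
    have "obeys K ([(prime R, [0,1,2])], [(R, [0,1,2])])"
      using b True unfolding backward_def by auto
    moreover have "holds K (prime R) [a0, a1, a2]"
      using t a unfolding holds_def by (intro bexI[of _ t]) (auto simp: less_Suc_eq numeral_2_eq_2)
    ultimately have "holds K R [a0, a1, a2]"
      unfolding obeys_def by (auto simp: vars_def dest: spec[of _ "nth [a0, a1, a2]"])
    then obtain u where u: "u \<in> tuples K R" "u 0 = Some a0" "u 1 = Some a1" "u 2 = Some a2"
      by (auto simp: holds_def less_Suc_eq numeral_2_eq_2)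
    have "u i = Some (\<tau>' (vs ! i))" if "i < length vs" for i
    proof -
      have "i = 0 \<or> i = 1 \<or> i = 2" using that len by auto
      then have "u i = t i" using u a by auto
      then show ?thesis using t that by auto
    qed
    then show ?thesis using u by (auto simp: holds_def)
  next
    case False
    then have "(R, vs) \<in> set (map (map_prod prime id) (snd r))"
      using R by (force simp: prime_def)
    then show ?thesis using 2 by blast
  qed
  with 1 show "\<exists>\<tau>'. (\<forall>x\<in>vars (fst r). \<tau>' x = \<tau> x) \<and> (\<forall>(R, vs)\<in>set (snd r). holds K R (map \<tau>' vs))"
    by blast
qed

lemma agree_outside_proc1:
  assumes "schema I = full 24"
  shows "agree_outside (scope proc1) I K \<longleftrightarrow>
    (\<forall>R. 10 \<le> R \<longrightarrow> R < 24 \<longrightarrow> tuples K R = tuples I R)"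
proof -
  have "mentioned (scope proc1) R \<longleftrightarrow> R < 10" "Whole R \<in> scope proc1 \<longleftrightarrow> R < 10" for R
    by (auto simp: mentioned_def proc1_def)
  then have "agree_outside (scope proc1) I K \<longleftrightarrow>
      (\<forall>R X. full 24 R = Some X \<longrightarrow> \<not> R < 10 \<longrightarrow> tuples I R = tuples K R)"
    unfolding agree_outside_def assms by simp
  then show ?thesis by (auto simp: full_def)
qed

text \<open>The empty scope of \<open>proc2\<close> makes its outcome equal to the intermediate
  instance \<open>K\<close>, which therefore satisfies both sets of postconditions.\<close>

lemma outcomes_seqD:
  assumes "schema I = full 24" "outcomes_seq proc1 proc2 I \<noteq> {}"
  obtains K where "\<And>R. 10 \<le> R \<Longrightarrow> R < 24 \<Longrightarrow> tuples K R = tuples I R" "\<forall>r\<in>set rules. obeys K r"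
proof -
  obtain K L where K: "K \<in> outcomes proc1 I" and L: "L \<in> outcomes proc2 K"
    using assms(2) by (auto simp: outcomes_seq_def outcomes_set_def)
  have sK: "schema K = full 24" and iK: "is_instance K" and sL: "schema L = full 24"
    and iL: "is_instance L"
    using K L assms(1) by (auto simp: outcomes_def)
  have "tuples L R = tuples K R" for R
  proof (cases "R < 24")
    case True
    then show ?thesis using L sK by (auto simp: outcomes_def agree_outside_def proc2_def mentioned_def full_def)
  next
    case False
    \<comment> \<open>Outside the schema both instances have the normalised value, the empty set, so
      equality of the records can be concluded.\<close>
    then show ?thesis using iK iL sK sL by (simp add: is_instance_def full_def)
  qed
  then have "L = K" using sK sL by (intro inst.equality) auto
  then have b: "\<forall>r\<in>set backward. obeys K r"
    using L models_rules[OF sK ok_backward] by (simp add: outcomes_def proc2_def)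
  have f: "\<forall>r\<in>set forward. obeys K r"
    using K models_rules[OF sK ok_forward] by (simp add: outcomes_def proc1_def)
  show ?thesis
  proof (rule that)
    show "\<forall>r\<in>set rules. obeys K r" using obeys_forward_backward[OF iK sK f b] by blast
    show "tuples K R = tuples I R" if "10 \<le> R" "R < 24" for R
      using K that agree_outside_proc1[OF assms(1)] by (simp add: outcomes_def)
  qed
qed

text \<open>\<open>K\<close> serves as the outcome of both procedures: if primed copies equal their
  originals, the forward rules say the same as the unprimed ones and copying back changes
  nothing.\<close>

lemma outcomes_seqI:
  assumes "schema I = full 24" "is_instance K" "schema K = full 24"
    and "\<And>R. 10 \<le> R \<Longrightarrow> R < 24 \<Longrightarrow> tuples K R = tuples I R"
    and primed: "\<And>R. R < 5 \<Longrightarrow> tuples K (prime R) = tuples K R"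
    and obeys: "\<forall>r\<in>set rules. obeys K r"
  shows "outcomes_seq proc1 proc2 I \<noteq> {}"
proof -
  have p: "holds K (prime R) vs = holds K R vs" for R vs
    using primed[of R] by (cases "R < 5") (auto simp: holds_def prime_def)
  have f: "obeys K r" if "r \<in> set forward" for r
  proof -
    from that have "r \<in> (\<lambda>r. (fst r, map (map_prod prime id) (snd r))) ` set rules"
      by (simp add: forward_def)
    then obtain r' where r: "r = (fst r', map (map_prod prime id) (snd r'))" and "r' \<in> set rules"
      by (rule imageE)
    then have "obeys K r'" using obeys by blast
    then show ?thesis unfolding obeys_def r by (simp add: case_prod_beta p)
  qed
  have b: "obeys K r" if "r \<in> set backward" for r
    using that unfolding backward_def by (auto simp: obeys_def p vars_def)
  have "K \<in> outcomes proc1 I"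
  proof -
    have "agree_outside (scope proc1) I K" using agree_outside_proc1 assms(1,4) by simp
    moreover have "models K (post proc1)"
      using f models_rules[OF assms(3) ok_forward] by (simp add: proc1_def)
    moreover have "applicable proc1 I" "preserved proc1 = {}"
      by (auto simp: applicable_def proc1_def models_def)
    ultimately show ?thesis using assms(1-3) by (simp add: outcomes_def)
  qed
  moreover have "K \<in> outcomes proc2 K"
  proof -
    have "agree_outside (scope proc2) K K" by (simp add: agree_outside_def)
    moreover have "models K (post proc2)"
      using b models_rules[OF assms(3) ok_backward] by (simp add: proc2_def)
    moreover have "applicable proc2 K" "preserved proc2 = {}"
      by (auto simp: applicable_def proc2_def models_def)
    ultimately show ?thesis using assms(2) by (simp add: outcomes_def)
  qed
  ultimately show ?thesis by (auto simp: outcomes_seq_def outcomes_set_def)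
qed

subsection \<open>Syntax trees\<close>

instance recf :: countable by countable_datatype

datatype node = Prog recf | Progs "recf list"

instance node :: countable by countable_datatype

abbreviation code :: "node \<Rightarrow> nat" where
  "code \<equiv> to_nat"

type_synonym fact = "rel \<times> val \<times> val \<times> val"

fun row :: "node \<Rightarrow> fact" where
  "row (Prog Zero) = (pZero, code (Prog Zero), 0, 0)"
| "row (Prog Succ) = (pSucc, code (Prog Succ), 0, 0)"
| "row (Prog (Proj 0)) = (pHd, code (Prog (Proj 0)), 0, 0)"
| "row (Prog (Proj (Suc i))) = (pTl, code (Prog (Proj (Suc i))), code (Prog (Proj i)), 0)"
| "row (Prog (Comp f gs)) = (pComp, code (Prog (Comp f gs)), code (Prog f), code (Progs gs))"
| "row (Prog (PrimRec f g)) = (pPrim, code (Prog (PrimRec f g)), code (Prog f), code (Prog g))"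
| "row (Prog (Mu f)) = (pMu, code (Prog (Mu f)), code (Prog f), 0)"
| "row (Progs []) = (pNil, code (Progs []), 0, 0)"
| "row (Progs (g # gs)) = (pCons, code (Progs (g # gs)), code (Prog g), code (Progs gs))"

function nodes :: "node \<Rightarrow> node set" where
  "nodes (Prog Zero) = {Prog Zero}"
| "nodes (Prog Succ) = {Prog Succ}"
| "nodes (Prog (Proj 0)) = {Prog (Proj 0)}"
| "nodes (Prog (Proj (Suc i))) = insert (Prog (Proj (Suc i))) (nodes (Prog (Proj i)))"
| "nodes (Prog (Comp f gs)) = insert (Prog (Comp f gs)) (nodes (Prog f) \<union> nodes (Progs gs))"
| "nodes (Prog (PrimRec f g)) = insert (Prog (PrimRec f g)) (nodes (Prog f) \<union> nodes (Prog g))"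
| "nodes (Prog (Mu f)) = insert (Prog (Mu f)) (nodes (Prog f))"
| "nodes (Progs []) = {Progs []}"
| "nodes (Progs (g # gs)) = insert (Progs (g # gs)) (nodes (Prog g) \<union> nodes (Progs gs))"
  by pat_completeness auto
termination
  \<comment> \<open>The index is a second component because \<open>Proj i\<close> is not a subterm
    of \<open>Proj (Suc i)\<close>.\<close>
  by (relation "inv_image (less_than <*lex*> less_than)
      (\<lambda>v. case v of Prog g \<Rightarrow> (size g, case g of Proj i \<Rightarrow> i | _ \<Rightarrow> 0) | Progs gs \<Rightarrow> (size_list size gs, 0))")
     auto

lemma finite_nodes: "finite (nodes v)"
  by (induction v rule: nodes.induct) auto

definition encodes :: "inst \<Rightarrow> node set \<Rightarrow> bool" where
  "encodes K V \<longleftrightarrow> (\<forall>v\<in>V. case row v of (R, a, b, c) \<Rightarrow> holds K R [a, b, c])"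

lemma holds_prefix: "holds K R (xs @ ys) \<Longrightarrow> holds K R xs"
  unfolding holds_def by (metis length_append nth_append trans_less_add1)

lemma holds_prefixes:
  "holds K R [a, b, c] \<Longrightarrow> holds K R [a, b]" "holds K R [a, b, c] \<Longrightarrow> holds K R [a]"
  using holds_prefix[of K R "[a, b]" "[c]"] holds_prefix[of K R "[a]" "[b, c]"] by auto

subsection \<open>Every model contains the results of all demanded computations\<close>

text \<open>In an arbitrary model nothing makes \<open>rSuc\<close> or \<open>rCons\<close>
  functional or injective, so a number or list may have many representatives. Representation is
  therefore a relation that follows chains of facts.\<close>

primrec num_repr :: "inst \<Rightarrow> nat \<Rightarrow> val \<Rightarrow> bool" where
  "num_repr K 0 v \<longleftrightarrow> holds K rZ [v]"
| "num_repr K (Suc n) v \<longleftrightarrow> (\<exists>w. num_repr K n w \<and> holds K rSuc [w, v])"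

primrec list_repr :: "inst \<Rightarrow> nat list \<Rightarrow> val \<Rightarrow> bool" where
  "list_repr K [] l \<longleftrightarrow> holds K rNil [l]"
| "list_repr K (x # xs) l \<longleftrightarrow>
     (\<exists>v m. num_repr K x v \<and> list_repr K xs m \<and> holds K rCons [v, m, l])"

section \<open>The rules as implications in an arbitrary model\<close>

context
  fixes K
  assumes obeys: "\<forall>r\<in>set rules. obeys K r"
    and zero: "holds K rZ [0]" and nil: "holds K rNil [0]"
begin

text \<open>Applied below with assignments \<open>nth [...]\<close>: the list gives the values of
  the body variables 0, 1, 2 and so on.\<close>

lemma rule_inst:
  assumes "i < length rules" "\<forall>(R, vs)\<in>set (fst (rules ! i)). holds K R (map \<tau> vs)"
  shows "\<exists>\<tau>'. (\<forall>x\<in>vars (fst (rules ! i)). \<tau>' x = \<tau> x) \<and>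
    (\<forall>(R, vs)\<in>set (snd (rules ! i)). holds K R (map \<tau>' vs))"
  using obeys assms nth_mem unfolding obeys_def by blast

lemma num_rules:
  assumes "holds K rNum [a, b, t]"
  shows "holds K rSuc [a, b]"
    and "holds K rRoot [p] \<Longrightarrow> holds K rNil [n] \<Longrightarrow> \<exists>l. holds K rCons [t, n, l] \<and> holds K rDem [p, l]"
    and "holds K rRoot [p] \<Longrightarrow> holds K rNil [n] \<Longrightarrow> holds K rCons [t, n, l] \<Longrightarrow> holds K rRes [p, l, v] \<Longrightarrow>
      holds K rSuc [w, v] \<Longrightarrow> holds K rFail [v]"
  using assms rule_inst[of 0 "nth [a, b, t]"] rule_inst[of 1 "nth [a, b, t, p, n]"]
    rule_inst[of 2 "nth [a, b, t, p, n, l, v, w]"]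
  by (auto simp: rules_def vars_def)

lemma base_rules:
  assumes "holds K rDem [p, l]"
  shows "holds K pZero [p] \<Longrightarrow> holds K rZ [z] \<Longrightarrow> holds K rRes [p, l, z]"
    and "holds K pSucc [p] \<Longrightarrow> holds K rCons [x, m, l] \<Longrightarrow> holds K rNil [m] \<Longrightarrow>
      \<exists>y. holds K rSuc [x, y] \<and> holds K rRes [p, l, y]"
    and "holds K pHd [p] \<Longrightarrow> holds K rCons [x, m, l] \<Longrightarrow> holds K rRes [p, l, x]"
    and "holds K pTl [p, q] \<Longrightarrow> holds K rCons [x, m, l] \<Longrightarrow> holds K rDem [q, m]"
    and "holds K pTl [p, q] \<Longrightarrow> holds K rCons [x, m, l] \<Longrightarrow> holds K rRes [q, m, v] \<Longrightarrow> holds K rRes [p, l, v]"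
  using assms rule_inst[of 3 "nth [p, l, z]"] rule_inst[of 4 "nth [p, l, x, m]"]
    rule_inst[of 5 "nth [p, l, x, m]"] rule_inst[of 6 "nth [p, l, x, m, q]"]
    rule_inst[of 7 "nth [p, l, x, m, q, v]"]
  by (auto simp: rules_def vars_def)

lemma list_rules:
  assumes "holds K rDem [p, l]"
  shows "holds K pNil [p] \<Longrightarrow> holds K rNil [z] \<Longrightarrow> holds K rRes [p, l, z]"
    and "holds K pCons [p, q, q'] \<Longrightarrow> holds K rDem [q, l] \<and> holds K rDem [q', l]"
    and "holds K pCons [p, q, q'] \<Longrightarrow> holds K rRes [q, l, x] \<Longrightarrow> holds K rRes [q', l, m] \<Longrightarrow>
      \<exists>l'. holds K rCons [x, m, l'] \<and> holds K rRes [p, l, l']"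
  using assms rule_inst[of 8 "nth [p, l, z]"] rule_inst[of 9 "nth [p, l, q, q']"]
    rule_inst[of 10 "nth [p, l, q, q', x, m]"]
  by (auto simp: rules_def vars_def)

lemma comp_rules:
  assumes "holds K rDem [p, l]" "holds K pComp [p, q, q']"
  shows "holds K rDem [q', l]"
    and "holds K rRes [q', l, m] \<Longrightarrow> holds K rDem [q, m]"
    and "holds K rRes [q', l, m] \<Longrightarrow> holds K rRes [q, m, v] \<Longrightarrow> holds K rRes [p, l, v]"
  using assms rule_inst[of 11 "nth [p, l, q, q']"] rule_inst[of 12 "nth [p, l, q, q', m]"]
    rule_inst[of 13 "nth [p, l, q, q', m, v]"]
  by (auto simp: rules_def vars_def)

lemma prim_rules:
  assumes "holds K rDem [p, l]" "holds K pPrim [p, q, q']" "holds K rCons [x, m, l]"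
  shows "holds K rZ [x] \<Longrightarrow> holds K rDem [q, m]"
    and "holds K rZ [x] \<Longrightarrow> holds K rRes [q, m, v] \<Longrightarrow> holds K rRes [p, l, v]"
    and "holds K rSuc [w, x] \<Longrightarrow> \<exists>l'. holds K rCons [w, m, l'] \<and> holds K rDem [p, l']"
  using assms rule_inst[of 14 "nth [p, l, q, q', x, m]"]
    rule_inst[of 15 "nth [p, l, q, q', x, m, v]"]
    rule_inst[of 16 "nth [p, l, q, q', x, m, w]"]
  by (auto simp: rules_def vars_def)

lemma prim_step_rules:
  assumes "holds K rDem [p, l]" "holds K pPrim [p, q, q']" "holds K rCons [x, m, l]"
    and "holds K rSuc [w, x]" "holds K rCons [w, m, l']" "holds K rRes [p, l', r]"
  shows "\<exists>m' m''. holds K rCons [r, m, m'] \<and> holds K rCons [w, m', m''] \<and> holds K rDem [q', m'']"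
    and "holds K rCons [r, m, m'] \<Longrightarrow> holds K rCons [w, m', m''] \<Longrightarrow> holds K rRes [q', m'', v] \<Longrightarrow>
      holds K rRes [p, l, v]"
proof -
  show "\<exists>m' m''. holds K rCons [r, m, m'] \<and> holds K rCons [w, m', m''] \<and> holds K rDem [q', m'']"
    using assms rule_inst[of 17 "nth [p, l, q, q', x, m, w, l', r]"]
    by (auto simp: rules_def vars_def)
  show "holds K rCons [r, m, m'] \<Longrightarrow> holds K rCons [w, m', m''] \<Longrightarrow> holds K rRes [q', m'', v] \<Longrightarrow>
      holds K rRes [p, l, v]"
    using assms rule_inst[of 18 "nth [p, l, q, q', x, m, w, l', r, m', m'', v]"]
    by (auto simp: rules_def vars_def)
qed

lemma mu_rules:
  assumes "holds K pMu [p, q]"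
  shows "holds K rDem [p, l] \<Longrightarrow> holds K rZ [z] \<Longrightarrow> holds K rSearch [p, l, z]"
    and "holds K rSearch [p, l, m] \<Longrightarrow> \<exists>l'. holds K rCons [m, l, l'] \<and> holds K rDem [q, l']"
    and "holds K rSearch [p, l, m] \<Longrightarrow> holds K rCons [m, l, l'] \<Longrightarrow> holds K rRes [q, l', v] \<Longrightarrow>
      holds K rZ [v] \<Longrightarrow> holds K rRes [p, l, m]"
    and "holds K rSearch [p, l, m] \<Longrightarrow> holds K rCons [m, l, l'] \<Longrightarrow> holds K rRes [q, l', v] \<Longrightarrow>
      holds K rSuc [w, v] \<Longrightarrow> \<exists>m'. holds K rSuc [m, m'] \<and> holds K rSearch [p, l, m']"
  using assms rule_inst[of 19 "nth [p, l, q, z]"] rule_inst[of 20 "nth [p, l, q, m]"]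
    rule_inst[of 21 "nth [p, l, q, m, l', v]"] rule_inst[of 22 "nth [p, l, q, m, l', v, w]"]
  by (auto simp: rules_def vars_def)

text \<open>Induction on the evaluation: a demand makes the rules demand the subcalls, and their
  results trigger the rule for the result. The representative \<open>l\<close> is arbitrary because
  the existential heads choose representatives of new lists at will.\<close>

lemma rec_eval_sound:
  "rec_eval g xs y \<Longrightarrow> encodes K (nodes (Prog g)) \<Longrightarrow> holds K rDem [code (Prog g), l] \<Longrightarrow>
    list_repr K xs l \<Longrightarrow> \<exists>v. holds K rRes [code (Prog g), l, v] \<and> num_repr K y v"
proof (induction g xs y arbitrary: l rule: rec_eval.induct)
  case (zero xs)
  then have "holds K pZero [code (Prog Zero)]" by (auto simp: encodes_def intro: holds_prefixes)
  then show ?case using base_rules(1)[OF zero(2) _ \<open>holds K rZ [0]\<close>] \<open>holds K rZ [0]\<close> by auto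
next
  case (succ x)
  then have "holds K pSucc [code (Prog Succ)]" by (auto simp: encodes_def intro: holds_prefixes)
  then show ?case using base_rules(2)[OF succ(2)] succ(3) by fastforce
next
  case (proj i xs)
  then show ?case
  \<comment> \<open>A projection descends through its children, dropping one list element at a
    time.\<close>
  proof (induction i arbitrary: xs l)
    case 0
    then have "holds K pHd [code (Prog (Proj 0))]" by (auto simp: encodes_def intro: holds_prefixes)
    with 0 base_rules(3)[OF 0(3)] show ?case by (cases xs) auto
  next
    case (Suc i)
    then have t: "holds K pTl [code (Prog (Proj (Suc i))), code (Prog (Proj i))]"
      by (auto simp: encodes_def intro: holds_prefixes)
    from Suc.prems obtain x ys where xs: "xs = x # ys" by (cases xs) auto
    with Suc.prems obtain a m where m: "list_repr K ys m" "holds K rCons [a, m, l]" by auto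
    have "holds K rDem [code (Prog (Proj i)), m]" using base_rules(4)[OF Suc.prems(3) t m(2)] .
    moreover have "encodes K (nodes (Prog (Proj i)))" using Suc.prems(2) by (simp add: encodes_def)
    ultimately obtain v where v: "holds K rRes [code (Prog (Proj i)), m, v]" "num_repr K (ys ! i) v"
      using Suc.IH[of ys m] Suc.prems(1) xs m(1) by auto
    then show ?case using base_rules(5)[OF Suc.prems(3) t m(2) v(1)] xs by auto
  qed
next
  case (comp xs gs ys f z)
  have t: "holds K pComp [code (Prog (Comp f gs)), code (Prog f), code (Progs gs)]"
    and ef: "encodes K (nodes (Prog f))" and eg: "encodes K (nodes (Progs gs))"
    using comp.prems(1) by (auto simp: encodes_def)
  \<comment> \<open>The node for the argument programs assembles their values into one list, to
    which \<open>f\<close> is then applied.\<close>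
  have "\<exists>m. holds K rRes [code (Progs gs), l, m] \<and> list_repr K ys m"
    using comp.IH(1) eg comp_rules(1)[OF comp.prems(2) t]
  proof (induction gs ys rule: list_all2_induct)
    case Nil
    then have "holds K pNil [code (Progs [])]" by (auto simp: encodes_def intro: holds_prefixes)
    then show ?case using list_rules(1)[OF Nil(2) _ nil] nil by auto
  next
    case (Cons g gs y ys)
    have t: "holds K pCons [code (Progs (g # gs)), code (Prog g), code (Progs gs)]"
      and e: "encodes K (nodes (Prog g))" "encodes K (nodes (Progs gs))"
      using Cons.prems(1) by (auto simp: encodes_def)
    from list_rules(2)[OF Cons.prems(2) t] obtain v m
      where "holds K rRes [code (Prog g), l, v]" "num_repr K y v"
        "holds K rRes [code (Progs gs), l, m]" "list_repr K ys m"
      using Cons e comp.prems(3) by blast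
    then show ?case using list_rules(3)[OF Cons.prems(2) t] by fastforce
  qed
  then obtain m where m: "holds K rRes [code (Progs gs), l, m]" "list_repr K ys m" by blast
  then obtain v where "holds K rRes [code (Prog f), m, v]" "num_repr K z v"
    using comp.IH(2)[OF ef comp_rules(2)[OF comp.prems(2) t]] by blast
  then show ?case using comp_rules(3)[OF comp.prems(2) t m(1)] by blast
next
  case (prim_0 f xs y g)
  have t: "holds K pPrim [code (Prog (PrimRec f g)), code (Prog f), code (Prog g)]"
    and ef: "encodes K (nodes (Prog f))"
    using prim_0.prems(1) by (auto simp: encodes_def)
  from prim_0.prems(3) obtain x m where x: "holds K rZ [x]" "list_repr K xs m" "holds K rCons [x, m, l]"
    by auto
  note r = prim_rules[OF prim_0.prems(2) t x(3)]
  obtain v where "holds K rRes [code (Prog f), m, v]" "num_repr K y v"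
    using prim_0.IH[OF ef r(1)] x by blast
  then show ?case using r(2) x by blast
next
  case (prim_Suc f g n xs r y)
  have t: "holds K pPrim [code (Prog (PrimRec f g)), code (Prog f), code (Prog g)]"
    and eg: "encodes K (nodes (Prog g))"
    using prim_Suc.prems(1) by (auto simp: encodes_def)
  from prim_Suc.prems(3) obtain x w m where x: "num_repr K n w" "holds K rSuc [w, x]"
    "list_repr K xs m" "holds K rCons [x, m, l]"
    by auto
  note pr = prim_rules[OF prim_Suc.prems(2) t x(4)]
  \<comment> \<open>\<open>x\<close> may have several predecessors; the recursion follows the one
    that shows \<open>x\<close> to represent \<open>Suc n\<close>.\<close>
  obtain l' where l': "holds K rCons [w, m, l']" "holds K rDem [code (Prog (PrimRec f g)), l']"
    using pr(3) x by blast
  then have "list_repr K (n # xs) l'" using x by auto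
  then obtain a where a: "holds K rRes [code (Prog (PrimRec f g)), l', a]" "num_repr K r a"
    using prim_Suc.IH(1)[OF prim_Suc.prems(1) l'(2)] by blast
  obtain m' m'' where m: "holds K rCons [a, m, m']" "holds K rCons [w, m', m'']"
    "holds K rDem [code (Prog g), m'']"
    using prim_step_rules(1)[OF prim_Suc.prems(2) t x(4) x(2) l'(1) a(1)] by blast
  then have "list_repr K (n # r # xs) m''" using x a by auto
  then obtain v where v: "holds K rRes [code (Prog g), m'', v]" "num_repr K y v"
    using prim_Suc.IH(2)[OF eg m(3)] by blast
  then show ?case
    using prim_step_rules(2)[OF prim_Suc.prems(2) t x(4) x(2) l'(1) a(1) m(1,2) v(1)] by blast
next
  case (mu f n xs)
  have t: "holds K pMu [code (Prog (Mu f)), code (Prog f)]" and ef: "encodes K (nodes (Prog f))"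
    using mu.prems(1) by (auto simp: encodes_def intro: holds_prefixes)
  note r = mu_rules[OF t]
  \<comment> \<open>The search moves past positive values only. Below \<open>n\<close> all values
    are positive, so it arrives at \<open>n\<close>.\<close>
  have "\<exists>v. holds K rSearch [code (Prog (Mu f)), l, v] \<and> num_repr K m v" if "m \<le> n" for m
    using that
  proof (induction m)
    case 0
    then show ?case using r(1)[OF mu.prems(2) zero] zero by auto
  next
    case (Suc m)
    then obtain v where v: "holds K rSearch [code (Prog (Mu f)), l, v]" "num_repr K m v" by auto
    obtain l' where l': "holds K rCons [v, l, l']" "holds K rDem [code (Prog f), l']"
      using r(2)[OF v(1)] by blast
    then have "list_repr K (m # xs) l'" using v mu.prems(3) by auto
    moreover from Suc.prems have "m < n" by simp
    ultimately obtain y u where u: "holds K rRes [code (Prog f), l', u]" "num_repr K (Suc y) u"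
      using mu.IH(2) ef l'(2) by blast
    then obtain w where "holds K rSuc [w, u]" by auto
    then obtain v' where "holds K rSuc [v, v']" "holds K rSearch [code (Prog (Mu f)), l, v']"
      using r(4)[OF v(1) l'(1) u(1)] by blast
    then show ?case using v(2) by auto
  qed
  then obtain v where v: "holds K rSearch [code (Prog (Mu f)), l, v]" "num_repr K n v" by blast
  obtain l' where l': "holds K rCons [v, l, l']" "holds K rDem [code (Prog f), l']"
    using r(2)[OF v(1)] by blast
  then have "list_repr K (n # xs) l'" using v mu.prems(3) by auto
  then obtain u where "holds K rRes [code (Prog f), l', u]" "num_repr K 0 u"
    using mu.IH(1)[OF ef l'(2)] by blast
  then show ?case using r(3)[OF v(1) l'(1)] v(2) by auto
qed

text \<open>The tuples of \<open>rNum\<close> become successor facts, so the value \<open>i\<close>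
  represents the number \<open>i\<close>. The evaluation is started by the tuple with
  \<open>i = 0\<close>, which exists as \<open>n\<close> is positive.\<close>

lemma rec_eval_Suc_fails:
  assumes "rec_eval e [n] (Suc y)" "encodes K (nodes (Prog e))" "holds K rRoot [code (Prog e)]"
    and n: "0 < n" "\<And>i. i < n \<Longrightarrow> holds K rNum [i, Suc i, n]"
  shows "\<exists>v. holds K rFail [v]"
proof -
  have N: "holds K rNum [0, Suc 0, n]" using n by blast
  have "num_repr K i i" if "i \<le> n" for i
    using that by (induction i) (auto simp: zero intro!: exI num_rules(1)[OF n(2)])
  then have "num_repr K n n" by simp
  moreover obtain l where l: "holds K rCons [n, 0, l]" "holds K rDem [code (Prog e), l]"
    using num_rules(2)[OF N assms(3) nil] by blast
  ultimately have "list_repr K [n] l" using nil by auto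
  then obtain v w where "holds K rRes [code (Prog e), l, v]" "holds K rSuc [w, v]"
    using rec_eval_sound[OF assms(1,2) l(2)] by auto
  then show ?thesis using num_rules(3)[OF N assms(3) nil l(1)] by blast
qed

end

subsection \<open>A finite model of a converging computation\<close>

text \<open>In the finite model a number stands for itself and a list for its
  \<open>list_encode\<close>; so the result of a list of programs is the code of the list of
  values.\<close>

fun sem :: "node \<Rightarrow> nat list \<Rightarrow> nat \<Rightarrow> bool" where
  "sem (Prog g) xs y \<longleftrightarrow> rec_eval g xs y"
| "sem (Progs gs) xs y \<longleftrightarrow> (\<exists>ys. y = list_encode ys \<and> list_all2 (\<lambda>g y. rec_eval g xs y) gs ys)"

lemma list_all2_rec_eval_unique:
  "list_all2 (\<lambda>g y. rec_eval g xs y) gs ys \<Longrightarrow> list_all2 (\<lambda>g y. rec_eval g xs y) gs zs \<Longrightarrow> ys = zs"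
  by (auto simp: list_all2_conv_all_nth intro!: nth_equalityI rec_eval_deterministic)

lemma sem_deterministic: "sem v xs y \<Longrightarrow> sem v xs z \<Longrightarrow> y = z"
  by (cases v) (auto dest: rec_eval_deterministic list_all2_rec_eval_unique)

text \<open>
  The children of a call are what the rules demand; they refer to the true values of
  subcomputations, so that closure under children does not depend on a choice of facts.
\<close>

inductive subcall :: "node \<times> nat list \<Rightarrow> node \<times> nat list \<Rightarrow> bool" where
  Proj: "subcall (Prog (Proj (Suc i)), x # xs) (Prog (Proj i), xs)"
| Args: "subcall (Prog (Comp f gs), xs) (Progs gs, xs)"
| Fun: "list_all2 (\<lambda>g y. rec_eval g xs y) gs ys \<Longrightarrow> subcall (Prog (Comp f gs), xs) (Prog f, ys)"
| Hd: "subcall (Progs (g # gs), xs) (Prog g, xs)"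
| Tl: "subcall (Progs (g # gs), xs) (Progs gs, xs)"
| Prim_0: "subcall (Prog (PrimRec f g), 0 # xs) (Prog f, xs)"
| Prim_Suc: "subcall (Prog (PrimRec f g), Suc n # xs) (Prog (PrimRec f g), n # xs)"
| Prim_step: "rec_eval (PrimRec f g) (n # xs) r \<Longrightarrow>
    subcall (Prog (PrimRec f g), Suc n # xs) (Prog g, n # r # xs)"
| Mu: "(\<And>k. k < m \<Longrightarrow> \<exists>y. rec_eval f (k # xs) (Suc y)) \<Longrightarrow>
    subcall (Prog (Mu f), xs) (Prog f, m # xs)"

definition calls :: "node \<times> nat list \<Rightarrow> (node \<times> nat list) set" where
  "calls c = {d. subcall\<^sup>*\<^sup>* c d}"

lemma calls_unfold: "calls c = insert c (\<Union>d\<in>{d. subcall c d}. calls d)"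
  unfolding calls_def by (auto elim: converse_rtranclpE intro: converse_rtranclp_into_rtranclp)

lemma finite_callsI:
  assumes "{d. subcall c d} \<subseteq> D" "finite D" "\<And>d. d \<in> D \<Longrightarrow> finite (calls d)"
  shows "finite (calls c)"
proof -
  have "finite {d. subcall c d}" using assms(1,2) by (rule finite_subset)
  then show ?thesis using assms(1,3) by (subst calls_unfold) blast
qed

text \<open>Induction on the evaluation, with finitely many subcalls at each call: where
  \<open>subcall\<close> refers to values, determinism leaves one possibility, and a minimisation
  does not go beyond its first zero.\<close>

lemma finite_calls: "rec_eval g xs y \<Longrightarrow> finite (calls (Prog g, xs))"
proof (induction g xs y rule: rec_eval.induct)
  case (zero xs)
  show ?case by (rule finite_callsI[of _ "{}"]) (auto elim: subcall.cases)
next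
  case (succ x)
  show ?case by (rule finite_callsI[of _ "{}"]) (auto elim: subcall.cases)
next
  case (proj i xs)
  have "finite (calls (Prog (Proj i), xs))" for i xs
  proof (induction i arbitrary: xs)
    case 0
    show ?case by (rule finite_callsI[of _ "{}"]) (auto elim: subcall.cases)
  next
    case (Suc i)
    show ?case
      \<comment> \<open>The empty list has no subcall, so the value of \<open>tl\<close> there is
        harmless.\<close>
      by (rule finite_callsI[of _ "{(Prog (Proj i), tl xs)}"]) (auto elim: subcall.cases simp: Suc)
  qed
  then show ?case .
next
  case (comp xs gs ys f z)
  from comp.IH(1) have "finite (calls (Progs gs, xs))"
  proof (induction gs ys rule: list_all2_induct)
    case Nil
    show ?case by (rule finite_callsI[of _ "{}"]) (auto elim: subcall.cases)
  next
    case (Cons g gs y ys)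
    have "{d. subcall (Progs (g # gs), xs) d} \<subseteq> {(Prog g, xs), (Progs gs, xs)}"
      by (auto elim!: subcall.cases)
    then show ?case by (rule finite_callsI) (use Cons in auto)
  qed
  moreover have ys: "list_all2 (\<lambda>g y. rec_eval g xs y) gs ys"
    using comp.IH(1) by (rule list_all2_mono) simp
  have sub: "{d. subcall (Prog (Comp f gs), xs) d} \<subseteq> {(Progs gs, xs), (Prog f, ys)}"
  proof (intro subsetI, elim CollectE)
    fix d assume "subcall (Prog (Comp f gs), xs) d"
    then show "d \<in> {(Progs gs, xs), (Prog f, ys)}"
    proof cases
      case (Fun zs)
      then show ?thesis using list_all2_rec_eval_unique[OF ys, of zs] by simp
    qed simp
  qed
  ultimately show ?case using comp.IH(2) by (intro finite_callsI[OF sub]) auto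
next
  case (prim_0 f xs y g)
  have "{d. subcall (Prog (PrimRec f g), 0 # xs) d} \<subseteq> {(Prog f, xs)}"
    by (auto elim!: subcall.cases)
  then show ?case by (rule finite_callsI) (use prim_0 in simp_all)
next
  case (prim_Suc f g n xs r y)
  have "d \<in> {(Prog (PrimRec f g), n # xs), (Prog g, n # r # xs)}"
    if "subcall (Prog (PrimRec f g), Suc n # xs) d" for d
    using that
  proof cases
    case (Prim_step r')
    then show ?thesis using rec_eval_deterministic[OF prim_Suc.hyps(1), of r'] by simp
  qed simp
  then have "{d. subcall (Prog (PrimRec f g), Suc n # xs) d} \<subseteq>
      {(Prog (PrimRec f g), n # xs), (Prog g, n # r # xs)}"
    by blast
  then show ?case by (rule finite_callsI) (use prim_Suc in auto)
next
  case (mu f n xs)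
  have le: "m \<le> n" if m: "\<And>k. k < m \<Longrightarrow> \<exists>y. rec_eval f (k # xs) (Suc y)" for m
  proof (rule ccontr)
    assume "\<not> m \<le> n"
    then have "n < m" by simp
    then obtain y where "rec_eval f (n # xs) (Suc y)" using m by blast
    then show False using rec_eval_deterministic[OF mu.hyps(1)] by blast
  qed
  have sub: "{d. subcall (Prog (Mu f), xs) d} \<subseteq> (\<lambda>m. (Prog f, m # xs)) ` {..n}"
  proof (intro subsetI, elim CollectE)
    fix d assume "subcall (Prog (Mu f), xs) d"
    then show "d \<in> (\<lambda>m. (Prog f, m # xs)) ` {..n}"
    proof cases
      case (Mu m)
      then have "m \<le> n" using le by blast
      then show ?thesis using Mu by blast
    qed
  qed
  have "finite (calls (Prog f, m # xs))" if "m \<le> n" for m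
  proof (cases "m = n")
    case False
    with that have "m < n" by simp
    then show ?thesis using mu.IH(2) by blast
  qed (use mu.IH(1) in simp)
  then show ?case by (intro finite_callsI[OF sub]) auto
qed

section \<open>Instances given by sets of facts\<close>

definition inst_of :: "nat \<Rightarrow> fact set \<Rightarrow> inst" where
  "inst_of k F = \<lparr>schema = full k,
     tuples = (\<lambda>R. {[0 \<mapsto> a, 1 \<mapsto> b, 2 \<mapsto> c] | a b c. (R, a, b, c) \<in> F \<and> R < k})\<rparr>"

lemma schema_inst_of [simp]: "schema (inst_of k F) = full k"
  by (simp add: inst_of_def)

lemma finite_tuples_inst_of: "finite F \<Longrightarrow> finite (tuples (inst_of k F) R)"
  by (rule finite_subset[of _ "(\<lambda>(R, a, b, c). [0 \<mapsto> a, 1 \<mapsto> b, 2 \<mapsto> c]) ` F"])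
    (force simp: inst_of_def)+

lemma is_instance_inst_of: "finite F \<Longrightarrow> is_instance (inst_of k F)"
proof -
  assume F: "finite F"
  have "dom (full k) = {..<k}" by (auto simp: full_def split: if_splits)
  then have "is_schema (full k)"
    by (auto simp: is_schema_def ran_def full_def split: if_splits)
  moreover have "dom [0 \<mapsto> a, 1 \<mapsto> b, 2 \<mapsto> c] = {0, 1, 2 :: nat}" for a b c :: nat by auto
  ultimately show ?thesis
    using finite_tuples_inst_of[OF F]
    by (auto simp: is_instance_def full_def inst_of_def split: if_splits)
qed

lemma holds_inst_of:
  assumes "R < k"
  shows "holds (inst_of k F) R [x] \<longleftrightarrow> (\<exists>y z. (R, x, y, z) \<in> F)"
    and "holds (inst_of k F) R [x, y] \<longleftrightarrow> (\<exists>z. (R, x, y, z) \<in> F)"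
    and "holds (inst_of k F) R [x, y, z] \<longleftrightarrow> (R, x, y, z) \<in> F"
proof -
  have 2: "i < Suc (Suc 0) \<longleftrightarrow> i = 0 \<or> i = 1" "i < Suc (Suc (Suc 0)) \<longleftrightarrow> i = 0 \<or> i = 1 \<or> i = 2"
    for i :: nat by auto
  show "holds (inst_of k F) R [x] \<longleftrightarrow> (\<exists>y z. (R, x, y, z) \<in> F)"
    using assms by (fastforce simp: holds_def inst_of_def)
  show "holds (inst_of k F) R [x, y] \<longleftrightarrow> (\<exists>z. (R, x, y, z) \<in> F)"
    using assms by (fastforce simp: holds_def inst_of_def 2)
  show "holds (inst_of k F) R [x, y, z] \<longleftrightarrow> (R, x, y, z) \<in> F"
    using assms by (fastforce simp: holds_def inst_of_def 2)
qed

lemma row_eq: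
  "row v = (pZero, a, b, c) \<longleftrightarrow> v = Prog Zero \<and> a = code v \<and> b = 0 \<and> c = 0"
  "row v = (pSucc, a, b, c) \<longleftrightarrow> v = Prog Succ \<and> a = code v \<and> b = 0 \<and> c = 0"
  "row v = (pHd, a, b, c) \<longleftrightarrow> v = Prog (Proj 0) \<and> a = code v \<and> b = 0 \<and> c = 0"
  "row v = (pTl, a, b, c) \<longleftrightarrow> (\<exists>i. v = Prog (Proj (Suc i)) \<and> a = code v \<and> b = code (Prog (Proj i)) \<and> c = 0)"
  "row v = (pComp, a, b, c) \<longleftrightarrow> (\<exists>f gs. v = Prog (Comp f gs) \<and> a = code v \<and> b = code (Prog f) \<and> c = code (Progs gs))"
  "row v = (pNil, a, b, c) \<longleftrightarrow> v = Progs [] \<and> a = code v \<and> b = 0 \<and> c = 0"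
  "row v = (pCons, a, b, c) \<longleftrightarrow> (\<exists>g gs. v = Progs (g # gs) \<and> a = code v \<and> b = code (Prog g) \<and> c = code (Progs gs))"
  "row v = (pPrim, a, b, c) \<longleftrightarrow> (\<exists>f g. v = Prog (PrimRec f g) \<and> a = code v \<and> b = code (Prog f) \<and> c = code (Prog g))"
  "row v = (pMu, a, b, c) \<longleftrightarrow> (\<exists>f. v = Prog (Mu f) \<and> a = code v \<and> b = code (Prog f) \<and> c = 0)"
  by (cases v rule: row.cases; auto)+

lemma row_rel: "row v = (R, t) \<Longrightarrow> 12 \<le> R \<and> R \<le> 20"
  by (cases v rule: row.cases) auto

definition program_facts :: "recf \<Rightarrow> fact set" where
  "program_facts e = row ` nodes (Prog e) \<union> {(rZ, 0, 0, 0), (rNil, 0, 0, 0), (rRoot, code (Prog e), 0, 0)}"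

definition number_facts :: "nat \<Rightarrow> fact set" where
  "number_facts n = (\<lambda>i. (rNum, i, Suc i, n)) ` {..<n}"

lemma finite_input_facts: "finite (program_facts e)" "finite (number_facts n)"
  by (simp_all add: program_facts_def number_facts_def finite_nodes)

definition zero_free :: "recf \<Rightarrow> nat list \<Rightarrow> nat \<Rightarrow> bool" where
  "zero_free f xs m \<longleftrightarrow> (\<forall>k<m. \<exists>y. rec_eval f (k # xs) (Suc y))"

text \<open>Numbers, list codes and program codes share the domain; the position in a relation tells
  which is meant. \<open>Suc (prod_encode (x, l))\<close> is the \<open>list_encode\<close> of the
  list with head \<open>x\<close> and tail code \<open>l\<close>. The cut-off \<open>B\<close> keeps
  the facts for \<open>rCons\<close> and \<open>rSuc\<close> finite in number.\<close>

definition trace_facts :: "(node \<times> nat list) set \<Rightarrow> nat \<Rightarrow> fact set" where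
  "trace_facts C B =
     {(rDem, code v, list_encode xs, 0) | v xs. (v, xs) \<in> C} \<union>
     {(rRes, code v, list_encode xs, y) | v xs y. (v, xs) \<in> C \<and> sem v xs y} \<union>
     {(rSearch, code (Prog (Mu f)), list_encode xs, m) | f xs m. (Prog (Mu f), xs) \<in> C \<and> zero_free f xs m} \<union>
     {(rCons, x, l, Suc (prod_encode (x, l))) | x l. Suc (prod_encode (x, l)) \<le> B} \<union>
     {(rSuc, k, Suc k, 0) | k. Suc k \<le> B}"

text \<open>Results are unique, so these triples lie on the graph of a function on
  \<open>C\<close>.\<close>

lemma finite_results:
  assumes "finite C"
  shows "finite {(v, xs, y). (v, xs) \<in> C \<and> sem v xs y}"
proof (rule finite_subset)
  have "(THE y. sem v xs y) = y" if "sem v xs y" for v xs y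
    using that by (rule the_equality) (rule sem_deterministic[OF _ that])
  then show "{(v, xs, y). (v, xs) \<in> C \<and> sem v xs y} \<subseteq> (\<lambda>(v, xs). (v, xs, THE y. sem v xs y)) ` C"
    by force
  show "finite ((\<lambda>(v, xs). (v, xs, THE y. sem v xs y)) ` C)" using assms by simp
qed

lemma finite_trace_facts:
  assumes "finite C" and closed: "\<And>c d. c \<in> C \<Longrightarrow> subcall c d \<Longrightarrow> d \<in> C"
  shows "finite (trace_facts C B)"
proof -
  have "finite {(rDem, code v, list_encode xs, 0 :: nat) | v xs. (v, xs) \<in> C}"
    by (rule finite_subset[of _ "(\<lambda>(v, xs). (rDem, code v, list_encode xs, 0)) ` C"])
      (use assms(1) in force)+
  moreover have "finite {(rRes, code v, list_encode xs, y) | v xs y. (v, xs) \<in> C \<and> sem v xs y}"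
    by (rule finite_subset[OF _ finite_imageI[OF finite_results[OF assms(1)],
      of "\<lambda>(v, xs, y). (rRes, code v, list_encode xs, y)"]]) force
  moreover have "finite {(rSearch, code (Prog (Mu f)), list_encode xs, m) | f xs m.
      (Prog (Mu f), xs) \<in> C \<and> zero_free f xs m}"
  proof (rule finite_subset)
    \<comment> \<open>A search fact for \<open>m\<close> comes from the call of \<open>f\<close> on
      \<open>m # xs\<close>, which lies in \<open>C\<close> by closure; head and tail recover
      \<open>m\<close> and \<open>xs\<close>. The value at \<open>Progs\<close> is a dummy.\<close>
    let ?h = "\<lambda>(v, xs). case v of Prog f \<Rightarrow> (rSearch, code (Prog (Mu f)), list_encode (tl xs), hd xs)
      | Progs _ \<Rightarrow> (0, 0, 0, 0)"
    show "finite (?h ` C)" using assms(1) by simp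
    have "(Prog f, m # xs) \<in> C" if "(Prog (Mu f), xs) \<in> C" "zero_free f xs m" for f xs m
      using closed[OF that(1)] that(2) subcall.Mu unfolding zero_free_def by blast
    then have "(rSearch, code (Prog (Mu f)), list_encode xs, m) \<in> ?h ` C"
      if "(Prog (Mu f), xs) \<in> C" "zero_free f xs m" for f xs m
      using that by (intro image_eqI[of _ _ "(Prog f, m # xs)"]) auto
    then show "{(rSearch, code (Prog (Mu f)), list_encode xs, m) | f xs m.
      (Prog (Mu f), xs) \<in> C \<and> zero_free f xs m} \<subseteq> ?h ` C" by blast
  qed
  moreover have "finite {(rCons, x, l, Suc (prod_encode (x, l))) | x l. Suc (prod_encode (x, l)) \<le> B}"
  proof (rule finite_subset)
    show "{(rCons, x, l, Suc (prod_encode (x, l))) | x l. Suc (prod_encode (x, l)) \<le> B} \<subseteq>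
      (\<lambda>(x, l). (rCons, x, l, Suc (prod_encode (x, l)))) ` ({..B} \<times> {..B})"
    proof (intro subsetI, elim CollectE exE conjE)
      fix z x l
      assume z: "z = (rCons, x, l, Suc (prod_encode (x, l)))" and "Suc (prod_encode (x, l)) \<le> B"
      then have "x \<le> B" "l \<le> B"
        using le_prod_encode_1[of x l] le_prod_encode_2[of l x] by linarith+
      then show "z \<in> (\<lambda>(x, l). (rCons, x, l, Suc (prod_encode (x, l)))) ` ({..B} \<times> {..B})"
        unfolding z by (intro image_eqI[of _ _ "(x, l)"]) simp_all
    qed
  qed simp
  moreover have "finite {(rSuc, k, Suc k, 0 :: nat) | k. Suc k \<le> B}"
    by (rule finite_subset[of _ "(\<lambda>k. (rSuc, k, Suc k, 0)) ` {..B}"]) auto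
  ultimately show ?thesis unfolding trace_facts_def by simp
qed

lemma list_encode_eq_Suc:
  "list_encode xs = Suc (prod_encode (x, l)) \<longleftrightarrow> (\<exists>ys. xs = x # ys \<and> l = list_encode ys)"
  "Suc (prod_encode (x, l)) = list_encode xs \<longleftrightarrow> (\<exists>ys. xs = x # ys \<and> l = list_encode ys)"
  by (cases xs; auto)+

lemma list_encode_eq_0: "list_encode xs = 0 \<longleftrightarrow> xs = []"
  by (cases xs) auto

section \<open>The model built from a closed set of calls\<close>

context
  fixes e n C B
  assumes value_0: "rec_eval e [n] 0"
    and root: "(Prog e, [n]) \<in> C"
    and closed: "\<And>c d. c \<in> C \<Longrightarrow> subcall c d \<Longrightarrow> d \<in> C"
    and bound_arg: "\<And>v xs. (v, xs) \<in> C \<Longrightarrow> list_encode xs \<le> B"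
    and bound_res: "\<And>v xs y. (v, xs) \<in> C \<Longrightarrow> sem v xs y \<Longrightarrow> y \<le> B"
begin

definition model_facts :: "fact set" where
  "model_facts = program_facts e \<union> number_facts n \<union> trace_facts C B \<union> apfst prime ` trace_facts C B"

definition model :: inst where
  "model = inst_of 24 model_facts"

lemma trace_facts_rel: "(R, t) \<in> trace_facts C B \<Longrightarrow> R < 5"
  by (auto simp: trace_facts_def)

lemma input_facts_rel: "(R, t) \<in> program_facts e \<union> number_facts n \<Longrightarrow> 10 \<le> R"
  by (auto simp: program_facts_def number_facts_def dest: row_rel[OF sym])

lemma primed_facts: "(R, t) \<in> apfst prime ` trace_facts C B \<longleftrightarrow> (\<exists>R'<5. R = R' + 5 \<and> (R', t) \<in> trace_facts C B)"
proof
  assume "(R, t) \<in> apfst prime ` trace_facts C B"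
  then obtain R' where "(R', t) \<in> trace_facts C B" "R = prime R'" by auto
  then show "\<exists>R'<5. R = R' + 5 \<and> (R', t) \<in> trace_facts C B"
    using trace_facts_rel[of R' t] by (auto simp: prime_def)
next
  assume "\<exists>R'<5. R = R' + 5 \<and> (R', t) \<in> trace_facts C B"
  then obtain R' where "(R', t) \<in> trace_facts C B" "R = prime R'" by (auto simp: prime_def)
  then show "(R, t) \<in> apfst prime ` trace_facts C B"
    by (intro image_eqI[of _ _ "(R', t)"]) simp_all
qed

lemma model_facts_trace: "R < 5 \<Longrightarrow> (R, t) \<in> model_facts \<longleftrightarrow> (R, t) \<in> trace_facts C B"
  unfolding model_facts_def using primed_facts[of R t] input_facts_rel[of R t] by auto

lemma model_facts_primed: "R < 5 \<Longrightarrow> (R + 5, t) \<in> model_facts \<longleftrightarrow> (R, t) \<in> trace_facts C B"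
  unfolding model_facts_def
  using primed_facts[of "R + 5" t] input_facts_rel[of "R + 5" t] trace_facts_rel[of "R + 5" t] by auto

lemma model_facts_input: "10 \<le> R \<Longrightarrow> (R, t) \<in> model_facts \<longleftrightarrow> (R, t) \<in> program_facts e \<union> number_facts n"
  unfolding model_facts_def using primed_facts[of R t] trace_facts_rel[of R t] by auto

lemma holds_trace:
  "R < 5 \<Longrightarrow> holds model R [x, y, z] \<longleftrightarrow> (R, x, y, z) \<in> trace_facts C B"
  "R < 5 \<Longrightarrow> holds model R [x, y] \<longleftrightarrow> (\<exists>z. (R, x, y, z) \<in> trace_facts C B)"
  by (simp_all add: model_def holds_inst_of model_facts_trace)

lemma holds_input:
  "10 \<le> R \<Longrightarrow> R < 24 \<Longrightarrow> holds model R [x, y, z] \<longleftrightarrow> (R, x, y, z) \<in> program_facts e \<union> number_facts n"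
  "10 \<le> R \<Longrightarrow> R < 24 \<Longrightarrow> holds model R [x, y] \<longleftrightarrow> (\<exists>z. (R, x, y, z) \<in> program_facts e \<union> number_facts n)"
  "10 \<le> R \<Longrightarrow> R < 24 \<Longrightarrow> holds model R [x] \<longleftrightarrow> (\<exists>y z. (R, x, y, z) \<in> program_facts e \<union> number_facts n)"
  by (simp_all add: model_def holds_inst_of model_facts_input del: Un_iff)

lemma holds_dem: "holds model rDem [p, l] \<longleftrightarrow> (\<exists>v xs. (v, xs) \<in> C \<and> p = code v \<and> l = list_encode xs)"
  by (subst holds_trace) (auto simp: trace_facts_def)

lemma holds_res: "holds model rRes [p, l, y] \<longleftrightarrow>
    (\<exists>v xs. (v, xs) \<in> C \<and> p = code v \<and> l = list_encode xs \<and> sem v xs y)"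
  by (subst holds_trace) (auto simp: trace_facts_def)

lemma holds_search: "holds model rSearch [p, l, m] \<longleftrightarrow>
    (\<exists>f xs. (Prog (Mu f), xs) \<in> C \<and> p = code (Prog (Mu f)) \<and> l = list_encode xs \<and> zero_free f xs m)"
  by (subst holds_trace) (auto simp: trace_facts_def)

lemma holds_cons: "holds model rCons [x, l, l'] \<longleftrightarrow> l' = Suc (prod_encode (x, l)) \<and> l' \<le> B"
  by (subst holds_trace) (auto simp: trace_facts_def)

lemma holds_suc: "holds model rSuc [x, y] \<longleftrightarrow> y = Suc x \<and> y \<le> B"
  by (subst holds_trace) (auto simp: trace_facts_def)

lemma holds_basic:
  "holds model rZ [x] \<longleftrightarrow> x = 0"
  "holds model rNil [x] \<longleftrightarrow> x = 0"
  "holds model rRoot [x] \<longleftrightarrow> x = code (Prog e)"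
  "holds model rNum [x, y, z] \<longleftrightarrow> x < n \<and> y = Suc x \<and> z = n"
proof -
  have *: "(R, t) \<notin> row ` nodes (Prog e)" if "R < 12 \<or> 20 < R" for R t
    using that by (auto dest: row_rel[OF sym])
  show "holds model rZ [x] \<longleftrightarrow> x = 0" "holds model rNil [x] \<longleftrightarrow> x = 0"
    "holds model rRoot [x] \<longleftrightarrow> x = code (Prog e)"
    "holds model rNum [x, y, z] \<longleftrightarrow> x < n \<and> y = Suc x \<and> z = n"
    using * by (auto simp: holds_input program_facts_def number_facts_def)
qed

lemma holds_table:
  assumes "10 \<le> R" "R \<le> 20" "R \<noteq> rZ" "R \<noteq> rNil"
  shows "holds model R [x] \<longleftrightarrow> (\<exists>v\<in>nodes (Prog e). \<exists>y z. row v = (R, x, y, z))"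
    and "holds model R [x, y] \<longleftrightarrow> (\<exists>v\<in>nodes (Prog e). \<exists>z. row v = (R, x, y, z))"
    and "holds model R [x, y, z] \<longleftrightarrow> (\<exists>v\<in>nodes (Prog e). row v = (R, x, y, z))"
proof -
  have "(R, t) \<in> program_facts e \<union> number_facts n \<longleftrightarrow> (\<exists>v\<in>nodes (Prog e). row v = (R, t))" for t
    using assms by (auto simp: program_facts_def number_facts_def image_iff) metis
  then show "holds model R [x] \<longleftrightarrow> (\<exists>v\<in>nodes (Prog e). \<exists>y z. row v = (R, x, y, z))"
    "holds model R [x, y] \<longleftrightarrow> (\<exists>v\<in>nodes (Prog e). \<exists>z. row v = (R, x, y, z))"
    "holds model R [x, y, z] \<longleftrightarrow> (\<exists>v\<in>nodes (Prog e). row v = (R, x, y, z))"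
    using assms by (simp_all add: holds_input del: Un_iff) blast+
qed

lemma table_imps:
  "holds model pZero [p] \<Longrightarrow> p = code (Prog Zero)"
  "holds model pSucc [p] \<Longrightarrow> p = code (Prog Succ)"
  "holds model pHd [p] \<Longrightarrow> p = code (Prog (Proj 0))"
  "holds model pTl [p, q] \<Longrightarrow> \<exists>i. p = code (Prog (Proj (Suc i))) \<and> q = code (Prog (Proj i))"
  "holds model pComp [p, q, q'] \<Longrightarrow>
    \<exists>f gs. p = code (Prog (Comp f gs)) \<and> q = code (Prog f) \<and> q' = code (Progs gs)"
  "holds model pNil [p] \<Longrightarrow> p = code (Progs [])"
  "holds model pCons [p, q, q'] \<Longrightarrow>
    \<exists>g gs. p = code (Progs (g # gs)) \<and> q = code (Prog g) \<and> q' = code (Progs gs)"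
  "holds model pPrim [p, q, q'] \<Longrightarrow>
    \<exists>f g. p = code (Prog (PrimRec f g)) \<and> q = code (Prog f) \<and> q' = code (Prog g)"
  "holds model pMu [p, q] \<Longrightarrow> \<exists>f. p = code (Prog (Mu f)) \<and> q = code (Prog f)"
  by (auto simp: holds_table row_eq)

text \<open>\<open>Suc (prod_encode (n, 0))\<close> is the code of \<open>[n]\<close>, the argument
  of the root call.\<close>

lemma bound_n: "Suc (prod_encode (n, 0)) \<le> B" "n \<le> B"
  using bound_arg[OF root] le_prod_encode_1[of n 0] by simp_all

text \<open>These keep the values created by the rules below the cut-off: each is a result or an
  argument of a call in \<open>C\<close>, or a part of one. In the fourth and fifth items,
  \<open>w # r # xs\<close> is the argument of a recursion step and \<open>r # xs\<close> its
  tail.\<close>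

lemma bounds:
  "(Prog f, xs) \<in> C \<Longrightarrow> rec_eval f xs y \<Longrightarrow> y \<le> B"
  "(Progs gs, xs) \<in> C \<Longrightarrow> list_all2 (\<lambda>g y. rec_eval g xs y) gs ys \<Longrightarrow> list_encode ys \<le> B"
  "(v, x # xs) \<in> C \<Longrightarrow> Suc (prod_encode (x, list_encode xs)) \<le> B"
  "(v, w # r # xs) \<in> C \<Longrightarrow> Suc (prod_encode (r, list_encode xs)) \<le> B"
  "(v, w # r # xs) \<in> C \<Longrightarrow>
    Suc (prod_encode (w, Suc (prod_encode (r, list_encode xs)))) \<le> B"
  "(Progs (g # gs), xs) \<in> C \<Longrightarrow> rec_eval g xs y \<Longrightarrow> list_all2 (\<lambda>g y. rec_eval g xs y) gs ys \<Longrightarrow>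
    Suc (prod_encode (y, list_encode ys)) \<le> B"
proof -
  show "Suc (prod_encode (y, list_encode ys)) \<le> B"
    if "(Progs (g # gs), xs) \<in> C" "rec_eval g xs y" "list_all2 (\<lambda>g y. rec_eval g xs y) gs ys"
  proof -
    have "list_all2 (\<lambda>g y. rec_eval g xs y) (g # gs) (y # ys)" using that by simp
    then have "sem (Progs (g # gs)) xs (list_encode (y # ys))" unfolding sem.simps by blast
    then show ?thesis using bound_res[OF that(1)] by fastforce
  qed
  show "(Prog f, xs) \<in> C \<Longrightarrow> rec_eval f xs y \<Longrightarrow> y \<le> B"
    using bound_res[of "Prog f" xs y] by simp
  show "(Progs gs, xs) \<in> C \<Longrightarrow> list_all2 (\<lambda>g y. rec_eval g xs y) gs ys \<Longrightarrow> list_encode ys \<le> B"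
    using bound_res[of "Progs gs" xs "list_encode ys"] by auto
  show "(v, x # xs) \<in> C \<Longrightarrow> Suc (prod_encode (x, list_encode xs)) \<le> B"
    using bound_arg[of v "x # xs"] by simp
  show *: "(v, w # r # xs) \<in> C \<Longrightarrow>
      Suc (prod_encode (w, Suc (prod_encode (r, list_encode xs)))) \<le> B"
    using bound_arg[of v "w # r # xs"] by simp
  show "(v, w # r # xs) \<in> C \<Longrightarrow> Suc (prod_encode (r, list_encode xs)) \<le> B"
    using * le_prod_encode_2[of "Suc (prod_encode (r, list_encode xs))" w] by linarith
qed

lemma rec_eval_Proj:
  "rec_eval (Proj 0) (x # xs) x"
  "rec_eval (Proj i) xs y \<Longrightarrow> rec_eval (Proj (Suc i)) (x # xs) y"
proof -
  show "rec_eval (Proj 0) (x # xs) x" using rec_eval.proj[of 0 "x # xs"] by simp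
  show "rec_eval (Proj (Suc i)) (x # xs) y" if "rec_eval (Proj i) xs y"
    using that rec_eval.proj[of "Suc i" "x # xs"] by (auto elim: rec_eval.cases)
qed

text \<open>The search position is the head of the argument of a call that the search
  demands.\<close>

lemma bound_search: "(Prog (Mu f), xs) \<in> C \<Longrightarrow> zero_free f xs m \<Longrightarrow> m \<le> B"
  using closed[OF _ subcall.Mu, of f xs m] bounds(3)[of "Prog f" m xs] le_prod_encode_1[of m "list_encode xs"]
  unfolding zero_free_def by fastforce

lemma zero_free_rules:
  "zero_free f xs 0"
  "zero_free f xs m \<Longrightarrow> rec_eval f (m # xs) (Suc y) \<Longrightarrow> zero_free f xs (Suc m)"
  "zero_free f xs m \<Longrightarrow> rec_eval f (m # xs) 0 \<Longrightarrow> rec_eval (Mu f) xs m"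
  "(Prog (Mu f), xs) \<in> C \<Longrightarrow> zero_free f xs m \<Longrightarrow> (Prog f, m # xs) \<in> C"
  using closed[OF _ subcall.Mu, of f xs m]
  by (auto simp: zero_free_def less_Suc_eq intro: rec_eval.mu)

section \<open>The model obeys each rule\<close>

lemmas model_simps = holds_dem holds_res[unfolded One_nat_def] holds_search holds_cons holds_suc holds_basic
  list_encode_eq list_encode_eq_Suc list_encode_eq_0

text \<open>In this series \<open>w\<close> sets the variables that occur in the head only; it is
  the identity for rules without such variables.\<close>

lemma model_rule0: "obeys model (rules ! 0)"
  using bound_n
  by (intro obeysI[where w = "\<lambda>\<tau>. \<tau>"]) (simp add: rules_def vars_def model_simps)

text \<open>Variable 5 becomes the code of \<open>[n]\<close>, so the demand is that of the root
  call.\<close>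

lemma model_rule1: "obeys model (rules ! 1)"
  using bound_n root
  by (intro obeysI[where w = "\<lambda>\<tau>. \<tau>(5 := list_encode [n])"])
    (simp add: rules_def vars_def model_simps)

text \<open>The body cannot match: the result of the root call is unique and equals 0, which is no
  successor.\<close>

lemma model_rule2: "obeys model (rules ! 2)"
  using value_0
  by (intro obeysI[where w = "\<lambda>\<tau>. \<tau>"])
    (auto simp: rules_def vars_def model_simps dest: rec_eval_deterministic)

lemma model_rule3: "obeys model (rules ! 3)"
  by (rule obeysI[where w = "\<lambda>\<tau>. \<tau>"])
    (auto simp: rules_def vars_def model_simps dest!: table_imps
      intro: rec_eval.zero)

lemma model_rule4: "obeys model (rules ! 4)"
  by (rule obeysI[where w = "\<lambda>\<tau>. \<tau>(4 := Suc (\<tau> 2))"])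
    (auto simp: rules_def vars_def model_simps dest!: table_imps
      intro: bounds(1) rec_eval.succ)

lemma model_rule5: "obeys model (rules ! 5)"
  by (rule obeysI[where w = "\<lambda>\<tau>. \<tau>"],
      auto simp: rules_def vars_def model_simps dest!: table_imps,
      rule rec_eval_Proj)

lemma model_rule6: "obeys model (rules ! 6)"
  by (rule obeysI[where w = "\<lambda>\<tau>. \<tau>"],
      auto simp: rules_def vars_def model_simps dest!: table_imps,
      erule closed[OF _ subcall.Proj])

lemma model_rule7: "obeys model (rules ! 7)"
  by (rule obeysI[where w = "\<lambda>\<tau>. \<tau>"])
    (auto simp: rules_def vars_def model_simps dest!: table_imps
      intro: rec_eval_Proj)

lemma model_rule8: "obeys model (rules ! 8)"
  by (rule obeysI[where w = "\<lambda>\<tau>. \<tau>"])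
    (auto simp: rules_def vars_def model_simps dest!: table_imps)

lemma model_rule9: "obeys model (rules ! 9)"
  by (rule obeysI[where w = "\<lambda>\<tau>. \<tau>"])
    (auto simp: rules_def vars_def model_simps dest!: table_imps
      intro: closed[OF _ subcall.Hd] closed[OF _ subcall.Tl])

lemma model_rule10: "obeys model (rules ! 10)"
  by (rule obeysI[where w = "\<lambda>\<tau>. \<tau>(6 := Suc (prod_encode (\<tau> 4, \<tau> 5)))"],
      auto simp: rules_def vars_def model_simps dest!: table_imps,
      rule bounds(6), assumption+)

lemma model_rule11: "obeys model (rules ! 11)"
  by (rule obeysI[where w = "\<lambda>\<tau>. \<tau>"])
    (auto simp: rules_def vars_def model_simps dest!: table_imps
      intro: closed[OF _ subcall.Args])

lemma model_rule12: "obeys model (rules ! 12)"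
  by (rule obeysI[where w = "\<lambda>\<tau>. \<tau>"],
      auto simp: rules_def vars_def model_simps dest!: table_imps,
      rule closed[OF _ subcall.Fun], assumption+)

lemma model_rule13: "obeys model (rules ! 13)"
  by (rule obeysI[where w = "\<lambda>\<tau>. \<tau>"])
    (auto simp: rules_def vars_def model_simps dest!: table_imps
      intro: rec_eval.comp)

lemma model_rule14: "obeys model (rules ! 14)"
  by (rule obeysI[where w = "\<lambda>\<tau>. \<tau>"],
      auto simp: rules_def vars_def model_simps dest!: table_imps,
      erule closed[OF _ subcall.Prim_0])

lemma model_rule15: "obeys model (rules ! 15)"
  by (rule obeysI[where w = "\<lambda>\<tau>. \<tau>"])
    (auto simp: rules_def vars_def model_simps dest!: table_imps
      intro: rec_eval.prim_0)

text \<open>Variable 7 is the argument list with its head lowered by one.\<close>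

lemma model_rule16: "obeys model (rules ! 16)"
  by (rule obeysI[where w = "\<lambda>\<tau>. \<tau>(7 := Suc (prod_encode (\<tau> 6, \<tau> 5)))"],
      auto simp: rules_def vars_def model_simps dest!: table_imps,
      (erule bounds(3)[OF closed[OF _ subcall.Prim_Suc]] closed[OF _ subcall.Prim_Suc])+)

text \<open>With the counter in variable 6 and the previous value in variable 8, variable 10 is the
  argument list of the step function and variable 9 is its tail.\<close>

lemma model_rule17: "obeys model (rules ! 17)"
  by (rule obeysI[where w = "\<lambda>\<tau>. \<tau>(9 := Suc (prod_encode (\<tau> 8, \<tau> 5)),
        10 := Suc (prod_encode (\<tau> 6, Suc (prod_encode (\<tau> 8, \<tau> 5)))))"],
      auto simp: rules_def vars_def model_simps dest!: table_imps,
      (rule bounds(4,5)[OF closed[OF _ subcall.Prim_step]] closed[OF _ subcall.Prim_step],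
        assumption, assumption)+)

lemma model_rule18: "obeys model (rules ! 18)"
  by (rule obeysI[where w = "\<lambda>\<tau>. \<tau>"],
      auto simp: rules_def vars_def model_simps dest!: table_imps,
      rule rec_eval.prim_Suc, assumption+)

lemma model_rule19: "obeys model (rules ! 19)"
  by (rule obeysI[where w = "\<lambda>\<tau>. \<tau>"])
    (auto simp: rules_def vars_def model_simps dest!: table_imps
      intro: zero_free_rules)

lemma model_rule20: "obeys model (rules ! 20)"
  by (rule obeysI[where w = "\<lambda>\<tau>. \<tau>(4 := Suc (prod_encode (\<tau> 3, \<tau> 1)))"],
      auto simp: rules_def vars_def model_simps dest!: table_imps,
      (rule bounds(3)[OF zero_free_rules(4)] zero_free_rules(4), assumption, assumption)+)

lemma model_rule21: "obeys model (rules ! 21)"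
  by (rule obeysI[where w = "\<lambda>\<tau>. \<tau>"])
    (auto simp: rules_def vars_def model_simps dest!: table_imps
      intro: zero_free_rules(3))

text \<open>A positive value at the current position extends the zero-free range by one, so the next
  position is again below \<open>B\<close>.\<close>

lemma model_rule22: "obeys model (rules ! 22)"
  by (rule obeysI[where w = "\<lambda>\<tau>. \<tau>(7 := Suc (\<tau> 3))"],
      auto simp: rules_def vars_def model_simps dest!: table_imps,
      (rule bound_search[OF _ zero_free_rules(2)], assumption+ | rule zero_free_rules(2), assumption+)+)

lemma tuples_model: "tuples model R = {[0 \<mapsto> a, 1 \<mapsto> b, 2 \<mapsto> c] | a b c. (R, a, b, c) \<in> model_facts \<and> R < 24}"
  by (simp add: model_def inst_of_def)

lemma obeys_model: "\<forall>r\<in>set rules. obeys model r"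
proof
  fix r assume "r \<in> set rules"
  then obtain i where r: "r = rules ! i" and "i < length rules" by (auto simp: in_set_conv_nth)
  then have "i < 23" by (simp add: rules_def)
  then have "i \<in> {0, 1, 2, 3, 4, 5, 6, 7, 8, 9, 10, 11, 12, 13, 14, 15, 16, 17, 18, 19, 20, 21, 22}"
    by (auto simp: numeral_eq_Suc less_Suc_eq)
  then show "obeys model r"
    unfolding r using model_rule0 model_rule1 model_rule2 model_rule3 model_rule4 model_rule5
      model_rule6 model_rule7 model_rule8 model_rule9 model_rule10 model_rule11 model_rule12
      model_rule13 model_rule14 model_rule15 model_rule16 model_rule17 model_rule18 model_rule19
      model_rule20 model_rule21 model_rule22
    by (elim insertE emptyE) simp_all
qed

lemma outcomes_nonempty:
  assumes "finite C"
  shows "outcomes_seq proc1 proc2 (inst_of 24 (program_facts e \<union> number_facts n)) \<noteq> {}"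
proof (rule outcomes_seqI[of _ model])
  have "finite model_facts"
    unfolding model_facts_def
    using finite_input_facts finite_trace_facts[OF assms closed] by simp
  then show "is_instance model" unfolding model_def by (rule is_instance_inst_of)
  show "tuples model R = tuples (inst_of 24 (program_facts e \<union> number_facts n)) R"
    if "10 \<le> R" for R
    unfolding tuples_model inst_of_def using model_facts_input[OF that] by simp
  show "tuples model (prime R) = tuples model R" if "R < 5" for R
    unfolding tuples_model
    using model_facts_primed[OF that] model_facts_trace[OF that] that by (simp add: prime_def)
  show "schema model = full 24" by (simp add: model_def)
qed (simp_all add: obeys_model)

end

section \<open>From the value of the program to the existence of outcomes\<close>

lemma value_0_outcome:
  assumes "rec_eval e [n] 0"
  shows "outcomes_seq proc1 proc2 (inst_of 24 (program_facts e \<union> number_facts n)) \<noteq> {}"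
proof -
  let ?C = "calls (Prog e, [n])"
  have fin: "finite ?C" using finite_calls[OF assms] .
  \<comment> \<open>All codes of arguments and all results; the set is finite, and any upper bound
    of it can be taken for \<open>B\<close>.\<close>
  let ?S = "(\<lambda>(v, xs). list_encode xs) ` ?C \<union> (\<lambda>(v, xs, y). y) ` {(v, xs, y). (v, xs) \<in> ?C \<and> sem v xs y}"
  have "finite ?S" using fin finite_results[OF fin] by simp
  then obtain B where B: "\<And>k. k \<in> ?S \<Longrightarrow> k \<le> B" unfolding finite_nat_set_iff_bounded_le by blast
  show ?thesis
  proof (rule outcomes_nonempty[OF assms _ _ _ _ fin])
    show "(Prog e, [n]) \<in> ?C" by (simp add: calls_def)
    show "d \<in> ?C" if "c \<in> ?C" "subcall c d" for c d
      using that by (auto simp: calls_def intro: rtranclp.rtrancl_into_rtrancl)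
    show "list_encode xs \<le> B" if "(v, xs) \<in> ?C" for v xs
      using that by (intro B) force
    show "y \<le> B" if "(v, xs) \<in> ?C" "sem v xs y" for v xs y
      using that by (intro B) force
  qed
qed

lemma value_1_no_outcome:
  assumes "rec_eval e [n] 1" "0 < n"
  shows "outcomes_seq proc1 proc2 (inst_of 24 (program_facts e \<union> number_facts n)) = {}"
proof (rule ccontr)
  let ?F = "program_facts e \<union> number_facts n"
  let ?I = "inst_of 24 ?F"
  assume "outcomes_seq proc1 proc2 ?I \<noteq> {}"
  then obtain K where K: "\<And>R. 10 \<le> R \<Longrightarrow> R < 24 \<Longrightarrow> tuples K R = tuples ?I R"
    and obeys: "\<forall>r\<in>set rules. obeys K r"
    by (rule outcomes_seqD[OF schema_inst_of]) blast
  \<comment> \<open>The input relations, among them the empty \<open>rFail\<close>, are outside the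
    scope and hence unchanged in \<open>K\<close>.\<close>
  have h: "holds K R xs \<longleftrightarrow> holds ?I R xs" if "10 \<le> R" "R < 24" for R xs
    using K[OF that] by (simp add: holds_def)
  have "holds K R [a, b, c]" if "v \<in> nodes (Prog e)" "row v = (R, a, b, c)" for v R a b c
  proof -
    have "(R, a, b, c) \<in> ?F" using that by (force simp: program_facts_def)
    then show ?thesis using row_rel[OF that(2)] by (simp add: h holds_inst_of del: Un_iff)
  qed
  then have "encodes K (nodes (Prog e))" by (auto simp: encodes_def)
  moreover have "holds K rZ [0]" "holds K rNil [0]" "holds K rRoot [code (Prog e)]"
    by (auto simp: h holds_inst_of program_facts_def)
  moreover have "holds K rNum [i, Suc i, n]" if "i < n" for i
    using that by (simp add: h holds_inst_of number_facts_def)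
  moreover have "rec_eval e [n] (Suc 0)" using assms(1) by simp
  ultimately obtain v where "holds K rFail [v]"
    using rec_eval_Suc_fails[OF obeys] assms(2) by blast
  then show False
    by (auto simp: h holds_inst_of program_facts_def number_facts_def dest: row_rel[OF sym])
qed

subsection \<open>Diagonalisation\<close>

text \<open>\<open>set_encode\<close> is a sum of powers of two, so a new relation contributes one
  new summand. The exponent is the code of the table of \<open>rNum\<close>.\<close>

definition with_number :: "nat \<Rightarrow> nat" where
  "with_number n = n + 2 ^ prod_encode (rNum, prod_encode (set_encode {0, 1, 2},
     \<Sum>i<n. 2 ^ list_encode [i, Suc i, n]))"

lemma computable_with_number: "computable 1 (\<lambda>xs. with_number (xs ! 0))"
proof -
  have "computable 2 (\<lambda>xs. list_encode [xs ! 0, Suc (xs ! 0), xs ! 1])"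
    by (simp, intro computable_Suc computable_prod_encode computable_nth computable_const) simp_all
  from computable_sum_power2[OF this] show ?thesis
    unfolding with_number_def
    by (intro computable_add computable_power2 computable_prod_encode computable_nth computable_const) simp_all
qed

text \<open>The smaller instance lacks \<open>rNum\<close> in its schema, and the tables of the
  other 23 relations are the same in both. So the encoded set gains exactly one element.\<close>

lemma code_instance_with_number:
  "code_instance (inst_of 24 (program_facts e \<union> number_facts n)) =
     code_instance (inst_of 23 (program_facts e)) +
     2 ^ prod_encode (rNum, prod_encode (set_encode {0, 1, 2}, \<Sum>i<n. 2 ^ list_encode [i, Suc i, n]))"
proof -
  let ?I = "inst_of 24 (program_facts e \<union> number_facts n)" and ?J = "inst_of 23 (program_facts e)"
  let ?c = "\<lambda>I R. prod_encode (R, code_table (the (schema I R)) (tuples I R))"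
  have dom: "dom (full k) = {..<k}" for k by (auto simp: full_def split: if_splits)
  have eq: "?c ?I R = ?c ?J R" if "R < 23" for R
  proof -
    have "(R, t) \<in> program_facts e \<union> number_facts n \<longleftrightarrow> (R, t) \<in> program_facts e" for t
      using that by (auto simp: number_facts_def)
    then have "tuples ?I R = tuples ?J R" unfolding inst_of_def using that by simp
    then show ?thesis using that by (simp add: full_def)
  qed
  have tup: "tuples ?I rNum = (\<lambda>i. [0 \<mapsto> i, 1 \<mapsto> Suc i, 2 \<mapsto> n]) ` {..<n}"
  proof -
    have "(rNum, t) \<in> program_facts e \<union> number_facts n \<longleftrightarrow> (\<exists>i<n. t = (i, Suc i, n))" for t
      by (auto simp: number_facts_def program_facts_def dest: row_rel[OF sym])
    then show ?thesis unfolding inst_of_def by auto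
  qed
  have "unnamed {0, 1, 2} [0 \<mapsto> i, 1 \<mapsto> Suc i, 2 \<mapsto> n] = [i, Suc i, n]" for i
    by (simp add: unnamed_def)
  then have "(\<lambda>t. list_encode (unnamed {0, 1, 2} t)) ` tuples ?I rNum =
      (\<lambda>i. list_encode [i, Suc i, n]) ` {..<n}"
    unfolding tup image_image by simp
  \<comment> \<open>\<open>set_encode\<close> sums over a set; distinct codes of the rows let the
    sum run over \<open>i\<close>.\<close>
  moreover have "inj_on (\<lambda>i. list_encode [i, Suc i, n]) {..<n}"
    by (rule inj_onI) (simp only: list_encode_eq list.inject)
  ultimately have "set_encode ((\<lambda>t. list_encode (unnamed {0, 1, 2} t)) ` tuples ?I rNum) =
      (\<Sum>i<n. 2 ^ list_encode [i, Suc i, n])"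
    by (simp only: set_encode_def sum.reindex comp_def)
  then have new: "?c ?I rNum =
      prod_encode (rNum, prod_encode (set_encode {0, 1, 2}, \<Sum>i<n. 2 ^ list_encode [i, Suc i, n]))"
    by (simp only: code_table_def schema_inst_of full_def) simp
  have all: "?c ?I ` {..<24} = insert (?c ?I rNum) (?c ?J ` {..<23})"
  proof -
    have "{..<24 :: nat} = insert 23 {..<23}" by auto
    moreover have "?c ?I ` {..<23} = ?c ?J ` {..<23}" by (rule image_cong[OF refl]) (simp only: eq lessThan_iff)
    ultimately show ?thesis by (simp only: image_insert)
  qed
  \<comment> \<open>Each code carries its relation name, and \<open>rNum\<close> is 23.\<close>
  have "?c ?I rNum \<notin> ?c ?J ` {..<23}" by (auto simp: prod_encode_eq)
  then have total: "set_encode (?c ?I ` {..<24}) = 2 ^ ?c ?I rNum + set_encode (?c ?J ` {..<23})"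
    unfolding all by (rule set_encode_insert[OF finite_imageI[OF finite_lessThan]])
  show ?thesis
    using total[unfolded new] unfolding code_instance_def schema_inst_of dom
    by (simp only: add.commute)
qed

text \<open>The schema has 23 relations, so the encoded set is nonempty even if the tables are
  empty.\<close>

lemma code_instance_pos: "0 < code_instance (inst_of 23 F)"
proof -
  have dom: "dom (full 23) = {..<23}" by (auto simp: full_def split: if_splits)
  show ?thesis
    unfolding code_instance_def schema_inst_of set_encode_def dom
    by (intro sum_pos) (auto simp: lessThan_empty_iff)
qed

lemma undecidable_outcomes:
  "\<not> decidable_on {I. is_instance I} code_instance (\<lambda>I. outcomes_seq proc1 proc2 I \<noteq> {})"
proof
  assume "decidable_on {I. is_instance I} code_instance (\<lambda>I. outcomes_seq proc1 proc2 I \<noteq> {})"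
  then obtain f where f: "\<And>I. is_instance I \<Longrightarrow>
      rec_eval f [code_instance I] (if outcomes_seq proc1 proc2 I \<noteq> {} then 1 else 0)"
    unfolding decidable_on_def by blast
  obtain g where g: "\<And>n. rec_eval g [n] (with_number n)"
  proof -
    obtain g where "\<And>xs. length xs = 1 \<Longrightarrow> rec_eval g xs (with_number (xs ! 0))"
      using computable_with_number unfolding computable_def by blast
    from this[of "[_]"] show ?thesis by (intro that[of g]) simp
  qed
  define e where "e = Comp f [g]"
  \<comment> \<open>There is no circularity: \<open>e\<close> does not mention \<open>n\<close> but
    receives it as its argument.\<close>
  define n where "n = code_instance (inst_of 23 (program_facts e))"
  let ?I = "inst_of 24 (program_facts e \<union> number_facts n)"
  have "code_instance ?I = with_number n"
    unfolding code_instance_with_number with_number_def n_def ..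
  moreover have "is_instance ?I" by (intro is_instance_inst_of) (simp add: finite_input_facts)
  ultimately have "rec_eval f [with_number n] (if outcomes_seq proc1 proc2 ?I \<noteq> {} then 1 else 0)"
    using f by metis
  then have e: "rec_eval e [n] (if outcomes_seq proc1 proc2 ?I \<noteq> {} then 1 else 0)"
    unfolding e_def by (intro rec_eval.comp[of _ _ "[with_number n]"]) (simp_all add: g)
  have "0 < n" unfolding n_def by (rule code_instance_pos)
  show False
  \<comment> \<open>The value of \<open>e\<close> at \<open>n\<close> is the verdict of
    \<open>f\<close> on \<open>?I\<close>, and either value forces the opposite of what it
    asserts.\<close>
  proof (cases "outcomes_seq proc1 proc2 ?I = {}")
    case True
    then show False using value_0_outcome[of e n] e by simp
  next
    case False
    then show False using value_1_no_outcome[of e n] e \<open>0 < n\<close> by simp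
  qed
qed

theorem proposition3:
  "\<exists>P\<^sub>1 P\<^sub>2.
     is_procedure P\<^sub>1 \<and> is_procedure P\<^sub>2 \<and>
     no_preconditions P\<^sub>1 \<and> no_preconditions P\<^sub>2 \<and>
     only_acyclic_tgds_post P\<^sub>1 \<and> only_acyclic_tgds_post P\<^sub>2 \<and>
     \<not> decidable_on {I. is_instance I} code_instance (\<lambda>I. outcomes_seq P\<^sub>1 P\<^sub>2 I \<noteq> {})"
proof (intro exI conjI)
  show "is_procedure proc1" "is_procedure proc2"
    using ok_forward ok_backward is_tgd_mk_tgd by (auto simp: is_procedure_def proc1_def proc2_def)
  show "no_preconditions proc1" "no_preconditions proc2"
    by (simp_all add: no_preconditions_def proc1_def proc2_def)
  show "only_acyclic_tgds_post proc1"
    using acyclic_forward by (auto simp: only_acyclic_tgds_post_def proc1_def)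
  show "only_acyclic_tgds_post proc2"
    using acyclic_backward by (auto simp: only_acyclic_tgds_post_def proc2_def)
qed (rule undecidable_outcomes)

end
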